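(* Let $A=\mathbb{Q}\langle x_1,\dots,x_n\mid C\rangle$ be a $G$-algebra over $\mathbb{Q}$ whose commutation relations $C:\ x_jx_i=c_{ij}\cdot x_ix_j+d_{ij}$, $1\le i<j\le n$, involve integer coefficients only, and fix a monomial ordering $>$ which is admissible for $A$. Let $\omega\in\mathbb{N}_{\ge 1}^n$ be such that all $c_{ij}\cdot x_ix_j+d_{ij}$ are $\omega$-homogeneous (so that $A$ is graded with respect to the $\omega$-weighted degree), and let $I\subset A$ be a nonzero left ideal given by $\omega$-homogeneous generators $f_1,\dots,f_r$ with integer coefficients. Let $\mathcal{G}\subset A\setminus\{0\}$ be a finite set. Suppose that 1. $\exp(\mathcal{G})=\exp(\mathcal{G}(p))$ for some good prime $p$, where $\mathcal{G}(p)$ is the reduced Gröbner basis of $\widetilde{I}_p={}_{A_p}\langle (f_1)_p,\dots,(f_r)_p\rangle\subset A_p$; 2. $\mathcal{G}$ is a left Gröbner basis (that is, a Gröbner basis for the left ideal $\langle\mathcal{G}\rangle\subset A$ it generates); and 3. $I\subset\langle\mathcal{G}\rangle$. Then $\mathcal{G}$ is a Gröbner basis for $I$. (All Gröbner bases and leading exponents are with respect to $>$.)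
   Context: Monomials and orderings. Let $K$ be a field. A standard monomial is $x^\alpha=x_1^{\alpha_1}\cdots x_n^{\alpha_n}$ with $\alpha\in\mathbb{N}^n$ ($0\in\mathbb{N}$). A standard polynomial is a $K$-linear combination $f=\sum c_\alpha x^\alpha$ of standard monomials in the free algebra $K\langle x_1,\dots,x_n\rangle$; its Newton diagram is $\mathcal{N}(f)=\{\alpha\mid c_\alpha\ne0\}$. A monomial ordering $>$ is a total well-ordering on $\mathbb{N}^n$ (equivalently, on standard monomials) such that $\alpha>\beta$ implies $\alpha+\gamma>\beta+\gamma$. The leading exponent $\exp(f)$ of $f\neq 0$ is the $>$-largest element of $\mathcal{N}(f)$. Let $\epsilon_i=\exp(x_i)$ be the $i$-th unit vector. $G$-algebras. A $G$-algebra over $K$ is an algebra $A=K\langle x_1,\dots,x_n\mid x_jx_i=c_{ij}x_ix_j+d_{ij},\ 1\le i<j\le n\rangle$ with $0\neq c_{ij}\in K$ and $d_{ij}$ standard polynomials such that: (i) there is a monomial ordering $>$ with $d_{ij}=0$ or $\epsilon_i+\epsilon_j>\exp(d_{ij})$ for all $i<j$ (any such ordering is called admissible for $A$); (ii) for all $i<j<k$ the element $c_{ik}c_{jk}d_{ij}x_k-x_kd_{ij}+c_{jk}x_jd_{ik}-c_{ij}d_{ik}x_j+d_{jk}x_i-c_{ij}c_{ik}x_id_{jk}$ reduces to zero with respect to the relations of $A$. The standard monomials form a $K$-basis of $A$, so coefficients, $\mathcal{N}(f)$ and $\exp(f)$ make sense for $f\in A$. Gradings. For $\omega\in\mathbb{N}^n$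 put $|\alpha|_\omega=\sum\omega_i\alpha_i$. An element $f$ is $\omega$-homogeneous of degree $d$ if $|\alpha|_\omega=d$ for all $\alpha\in\mathcal{N}(f)$. If all $c_{ij}x_ix_j+d_{ij}$ are $\omega$-homogeneous, then $A=\bigoplus_{d\ge0}A_d$ with $A_d$ the $\omega$-homogeneous elements of degree $d$. Gröbner bases. For a nonzero left ideal $I\subset A$, $\exp(I)=\{\exp(f)\mid f\in I\setminus\{0\}\}$; a Gröbner basis for $I$ is a finite set $\mathcal{G}\subset I\setminus\{0\}$ with $\exp(I)=\bigcup_{g\in\mathcal{G}}(\exp(g)+\mathbb{N}^n)$. It is reduced if each $g\in\mathcal{G}$ has leading coefficient $1$ and no element of $\mathcal{N}(g)$ lies in $\exp(h)+\mathbb{N}^n$ for any $h\in\mathcal{G}$, $h\ne g$; every left ideal has a unique reduced Gröbner basis (empty for the zero ideal). For a finite set $\mathcal{G}$ of nonzero elements, $\exp(\mathcal{G})=\{\exp(g)\mid g\in\mathcal{G}\}$. $\langle T\rangle$ denotes the left ideal generated by $T$. Reduction mod $p$. Call a prime $p$ good if it divides no $c_{ij}$ and no (nonzero) coefficient of any $d_{ij}$. For a good prime $p$, $A_p=\mathbb{F}_p\langle x_1,\dots,x_n\mid C_p\rangle$ is the $G$-algebra over $\mathbb{F}_p$ whose relations $C_p$ are obtained from $C$ by reducing all coefficients modulo $p$; $>$ is admissible for $A_p$. For $f\in A$ with integer coefficients, $f_p\in A_p$ is obtained by reducing each coefficient modulo $p$. *)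

theory Defs
  imports
    "HOL-Library.Poly_Mapping"
    "HOL-Algebra.QuotRing"
    "Berlekamp_Zassenhaus.Finite_Field"
begin

section \<open>The free algebra and standard polynomials\<close>

text \<open>
  The variables \<open>x\<^sub>1, \<dots>, x\<^sub>n\<close> are indexed by a finite linearly ordered type \<open>'n\<close> with \<open>n\<close> elements.
  Words in the variables form the free monoid, written additively because the convolution
  product of \<open>_ \<Rightarrow>\<^sub>0 _\<close> adds the keys. Hence \<open>'n fword \<Rightarrow>\<^sub>0 'k\<close> with its type class ring structure
  is the free associative algebra over \<open>'k\<close>.
\<close>

datatype 'n fword = Word (letters: "'n list")

instantiation fword :: (type) monoid_add
begin

definition zero_fword :: "'a fword" where "0 = Word []"

definition plus_fword :: "'a fword \<Rightarrow> 'a fword \<Rightarrow> 'a fword" where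
  "v + w = Word (letters v @ letters w)"

instance
  by standard (auto simp: zero_fword_def plus_fword_def)

end

type_synonym ('n, 'k) free_poly = "'n fword \<Rightarrow>\<^sub>0 'k"

text \<open>Exponent vectors, i.e. elements of \<open>\<nat>\<^sup>n\<close>; finite support is automatic for finite \<open>'n\<close>.\<close>
type_synonym 'n expo = "'n \<Rightarrow>\<^sub>0 nat"

definition X :: "'n \<Rightarrow> ('n, 'k::field) free_poly" where
  "X i = Poly_Mapping.single (Word [i]) 1"

definition const :: "'k::field \<Rightarrow> ('n, 'k) free_poly" where
  "const a = Poly_Mapping.single 0 a"

text \<open>The standard monomial \<open>x\<^sub>1\<^bsup>\<alpha>\<^sub>1\<^esup> \<cdots> x\<^sub>n\<^bsup>\<alpha>\<^sub>n\<^esup>\<close> as a word.\<close>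
definition std_word :: "'n::{finite,linorder} expo \<Rightarrow> 'n fword" where
  "std_word \<alpha> =
     Word (concat (map (\<lambda>i. replicate (Poly_Mapping.lookup \<alpha> i) i) (sorted_list_of_set UNIV)))"

definition standard :: "('n::{finite,linorder}, 'k::field) free_poly \<Rightarrow> bool" where
  "standard f \<longleftrightarrow> Poly_Mapping.keys f \<subseteq> range std_word"

definition newton :: "('n::{finite,linorder}, 'k::field) free_poly \<Rightarrow> 'n expo set" where
  "newton f = {\<alpha>. Poly_Mapping.lookup f (std_word \<alpha>) \<noteq> 0}"

definition unit_expo :: "'n \<Rightarrow> 'n expo" where
  "unit_expo i = Poly_Mapping.single i 1"


section \<open>Monomial orderings\<close>

text \<open>\<open>lt \<beta> \<alpha>\<close> is the strict relation \<open>\<alpha> > \<beta>\<close>.\<close>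
definition monomial_ordering :: "('n expo \<Rightarrow> 'n expo \<Rightarrow> bool) \<Rightarrow> bool" where
  "monomial_ordering lt \<longleftrightarrow>
     irreflp lt \<and> transp lt \<and> totalp lt \<and> wfp lt \<and>
     (\<forall>\<alpha> \<beta> \<gamma>. lt \<beta> \<alpha> \<longrightarrow> lt (\<beta> + \<gamma>) (\<alpha> + \<gamma>))"

text \<open>Meaningful for nonzero standard \<open>f\<close>.\<close>
definition lead_exp ::
  "('n expo \<Rightarrow> 'n expo \<Rightarrow> bool) \<Rightarrow> ('n::{finite,linorder}, 'k::field) free_poly \<Rightarrow> 'n expo" where
  "lead_exp lt f = (THE \<alpha>. \<alpha> \<in> newton f \<and> (\<forall>\<beta> \<in> newton f. \<beta> \<noteq> \<alpha> \<longrightarrow> lt \<beta> \<alpha>))"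


section \<open>G-algebras\<close>

text \<open>Only the values \<open>c i j\<close> and \<open>d i j\<close> for \<open>i < j\<close> play a role.\<close>

type_synonym ('n, 'k) coeffs = "'n \<Rightarrow> 'n \<Rightarrow> 'k"
type_synonym ('n, 'k) tails = "'n \<Rightarrow> 'n \<Rightarrow> ('n, 'k) free_poly"

definition rel_rhs ::
  "('n, 'k::field) coeffs \<Rightarrow> ('n, 'k) tails \<Rightarrow> 'n \<Rightarrow> 'n \<Rightarrow> ('n, 'k) free_poly" where
  "rel_rhs c d i j = const (c i j) * X i * X j + d i j"

definition admissible ::
  "('n expo \<Rightarrow> 'n expo \<Rightarrow> bool) \<Rightarrow> ('n::{finite,linorder}, 'k::field) tails \<Rightarrow> bool" where
  "admissible lt d \<longleftrightarrow> monomial_ordering lt \<and>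
     (\<forall>i j. i < j \<longrightarrow> d i j = 0 \<or> lt (lead_exp lt (d i j)) (unit_expo i + unit_expo j))"

text \<open>
  One reduction step picks a term of \<open>f\<close> whose word contains \<open>x\<^sub>j x\<^sub>i\<close> with \<open>i < j\<close> and replaces this
  factor by \<open>c\<^sub>i\<^sub>j x\<^sub>i x\<^sub>j + d\<^sub>i\<^sub>j\<close>.
\<close>
definition reduction_step ::
  "('n::linorder, 'k::field) coeffs \<Rightarrow> ('n, 'k) tails \<Rightarrow>
   ('n, 'k) free_poly \<Rightarrow> ('n, 'k) free_poly \<Rightarrow> bool" where
  "reduction_step c d f g \<longleftrightarrow>
     (\<exists>i j u v a. i < j \<and>
        a = Poly_Mapping.lookup f (u + Word [j, i] + v) \<and> a \<noteq> 0 \<and>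
        g = f - Poly_Mapping.single u a * (X j * X i - rel_rhs c d i j) * Poly_Mapping.single v 1)"

definition reduces_to_zero ::
  "('n::linorder, 'k::field) coeffs \<Rightarrow> ('n, 'k) tails \<Rightarrow> ('n, 'k) free_poly \<Rightarrow> bool" where
  "reduces_to_zero c d f \<longleftrightarrow> (reduction_step c d)\<^sup>*\<^sup>* f 0"

definition nondeg ::
  "('n, 'k::field) coeffs \<Rightarrow> ('n, 'k) tails \<Rightarrow> 'n \<Rightarrow> 'n \<Rightarrow> 'n \<Rightarrow> ('n, 'k) free_poly" where
  "nondeg c d i j k =
     const (c i k * c j k) * d i j * X k - X k * d i j
     + const (c j k) * X j * d i k - const (c i j) * d i k * X j
     + d j k * X i - const (c i j * c i k) * X i * d j k"

definition G_algebra ::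
  "('n::{finite,linorder}, 'k::field) coeffs \<Rightarrow> ('n, 'k) tails \<Rightarrow> bool" where
  "G_algebra c d \<longleftrightarrow>
     (\<forall>i j. i < j \<longrightarrow> c i j \<noteq> 0 \<and> standard (d i j)) \<and>
     (\<exists>lt. admissible lt d) \<and>
     (\<forall>i j k. i < j \<and> j < k \<longrightarrow> reduces_to_zero c d (nondeg c d i j k))"

text \<open>The free algebra as a ring record, and the algebra presented by the relations.\<close>

definition free_alg :: "('n, 'k::field) free_poly ring" where
  "free_alg = \<lparr>carrier = UNIV, monoid.mult = (*), one = 1, zero = 0, add = (+)\<rparr>"

definition relators ::
  "('n::linorder, 'k::field) coeffs \<Rightarrow> ('n, 'k) tails \<Rightarrow> ('n, 'k) free_poly set" where
  "relators c d = {X j * X i - rel_rhs c d i j | i j. i < j}"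

definition G_alg ::
  "('n::linorder, 'k::field) coeffs \<Rightarrow> ('n, 'k) tails \<Rightarrow> ('n, 'k) free_poly set ring" where
  "G_alg c d = free_alg Quot (Idl\<^bsub>free_alg\<^esub> (relators c d))"

definition residue_class ::
  "('n::linorder, 'k::field) coeffs \<Rightarrow> ('n, 'k) tails \<Rightarrow>
   ('n, 'k) free_poly \<Rightarrow> ('n, 'k) free_poly set" where
  "residue_class c d f = (Idl\<^bsub>free_alg\<^esub> (relators c d)) +>\<^bsub>free_alg\<^esub> f"

text \<open>
  An element of a G-algebra is a residue class. As the standard monomials form a basis,
  it contains exactly one standard polynomial, which yields its coefficients, Newton diagram
  and leading exponent.
\<close>
definition std_repr ::
  "('n::{finite,linorder}, 'k::field) free_poly set \<Rightarrow> ('n, 'k) free_poly" where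
  "std_repr a = (THE f. standard f \<and> f \<in> a)"

definition exp_of ::
  "('n expo \<Rightarrow> 'n expo \<Rightarrow> bool) \<Rightarrow> ('n::{finite,linorder}, 'k::field) free_poly set \<Rightarrow> 'n expo" where
  "exp_of lt a = lead_exp lt (std_repr a)"

definition lead_coeff_of ::
  "('n expo \<Rightarrow> 'n expo \<Rightarrow> bool) \<Rightarrow> ('n::{finite,linorder}, 'k::field) free_poly set \<Rightarrow> 'k" where
  "lead_coeff_of lt a = Poly_Mapping.lookup (std_repr a) (std_word (exp_of lt a))"


section \<open>Weighted homogeneity\<close>

definition wdeg :: "('n::finite \<Rightarrow> nat) \<Rightarrow> 'n expo \<Rightarrow> nat" where
  "wdeg \<omega> \<alpha> = (\<Sum>i\<in>UNIV. \<omega> i * Poly_Mapping.lookup \<alpha> i)"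

definition homogeneous ::
  "('n::{finite,linorder} \<Rightarrow> nat) \<Rightarrow> ('n, 'k::field) free_poly \<Rightarrow> bool" where
  "homogeneous \<omega> f \<longleftrightarrow> (\<exists>e. \<forall>\<alpha> \<in> newton f. wdeg \<omega> \<alpha> = e)"


section \<open>Left ideals and Groebner bases\<close>

definition left_ideal :: "'a set \<Rightarrow> ('a, 'm) ring_scheme \<Rightarrow> bool" where
  "left_ideal I R \<longleftrightarrow> additive_subgroup I R \<and> (\<forall>r \<in> carrier R. \<forall>x \<in> I. r \<otimes>\<^bsub>R\<^esub> x \<in> I)"

definition left_ideal_gen :: "('a, 'm) ring_scheme \<Rightarrow> 'a set \<Rightarrow> 'a set" where
  "left_ideal_gen R T = \<Inter>{I. left_ideal I R \<and> T \<subseteq> I}"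

definition groebner_basis ::
  "('n expo \<Rightarrow> 'n expo \<Rightarrow> bool) \<Rightarrow> ('n::{finite,linorder}, 'k::field) free_poly set ring \<Rightarrow>
   ('n, 'k) free_poly set set \<Rightarrow> ('n, 'k) free_poly set set \<Rightarrow> bool" where
  "groebner_basis lt A G I \<longleftrightarrow>
     finite G \<and> G \<subseteq> I - {\<zero>\<^bsub>A\<^esub>} \<and>
     exp_of lt ` (I - {\<zero>\<^bsub>A\<^esub>}) = (\<Union>g\<in>G. range (\<lambda>\<gamma>. exp_of lt g + \<gamma>))"

definition reduced_groebner_basis ::
  "('n expo \<Rightarrow> 'n expo \<Rightarrow> bool) \<Rightarrow> ('n::{finite,linorder}, 'k::field) free_poly set ring \<Rightarrow>
   ('n, 'k) free_poly set set \<Rightarrow> ('n, 'k) free_poly set set \<Rightarrow> bool" where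
  "reduced_groebner_basis lt A G I \<longleftrightarrow>
     groebner_basis lt A G I \<and>
     (\<forall>g\<in>G. lead_coeff_of lt g = 1) \<and>
     (\<forall>g\<in>G. \<forall>h\<in>G. h \<noteq> g \<longrightarrow> newton (std_repr g) \<inter> range (\<lambda>\<gamma>. exp_of lt h + \<gamma>) = {})"


section \<open>Reduction modulo a prime\<close>

text \<open>
  \<open>'p mod_ring\<close> with \<open>'p :: prime_card\<close> is the field with \<open>CARD('p)\<close> elements, and every prime is
  the cardinality of such a type. The reduction map below is meaningful for integers
  (viewed as rationals) only; on them the floor is the identity.
\<close>

definition integral_poly :: "('n, rat) free_poly \<Rightarrow> bool" where
  "integral_poly f \<longleftrightarrow> (\<forall>w. Poly_Mapping.lookup f w \<in> \<int>)"

definition red_coeff :: "rat \<Rightarrow> 'p::prime_card mod_ring" where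
  "red_coeff q = of_int \<lfloor>q\<rfloor>"

definition red_poly :: "('n, rat) free_poly \<Rightarrow> ('n, 'p::prime_card mod_ring) free_poly" where
  "red_poly f = Poly_Mapping.map red_coeff f"

definition red_coeffs :: "('n, rat) coeffs \<Rightarrow> ('n, 'p::prime_card mod_ring) coeffs" where
  "red_coeffs c = (\<lambda>i j. red_coeff (c i j))"

definition red_tails :: "('n, rat) tails \<Rightarrow> ('n, 'p::prime_card mod_ring) tails" where
  "red_tails d = (\<lambda>i j. red_poly (d i j))"

definition good_prime :: "nat \<Rightarrow> ('n::linorder, rat) coeffs \<Rightarrow> ('n, rat) tails \<Rightarrow> bool" where
  "good_prime p c d \<longleftrightarrow> Factorial_Ring.prime p \<and>
     (\<forall>i j. i < j \<longrightarrow> \<not> int p dvd \<lfloor>c i j\<rfloor> \<and>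
        (\<forall>w. Poly_Mapping.lookup (d i j) w \<noteq> 0 \<longrightarrow> \<not> int p dvd \<lfloor>Poly_Mapping.lookup (d i j) w\<rfloor>))"

definition G_alg_mod ::
  "('n::linorder, rat) coeffs \<Rightarrow> ('n, rat) tails \<Rightarrow> ('n, 'p::prime_card mod_ring) free_poly set ring"
  where "G_alg_mod c d = G_alg (red_coeffs c) (red_tails d)"

definition red_elem ::
  "('n::{finite,linorder}, rat) coeffs \<Rightarrow> ('n, rat) tails \<Rightarrow>
   ('n, rat) free_poly set \<Rightarrow> ('n, 'p::prime_card mod_ring) free_poly set" where
  "red_elem c d a = residue_class (red_coeffs c) (red_tails d) (red_poly (std_repr a))"

end

theory Submission
  imports Defs
begin

text \<open>
  The elements \<open>x\<^sup>\<alpha> f\<^sub>i\<close> of weighted degree \<open>D\<close> span the degree-\<open>D\<close> part of the left ideal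
  generated by the \<open>f\<^sub>i\<close>, over the rationals as well as modulo \<open>p\<close>. Their coordinate vectors with
  respect to the standard monomials are integral, and the rank of an integral matrix can only drop
  when it is reduced modulo \<open>p\<close>. The number of leading exponents of degree \<open>D\<close> is the dimension of
  the degree-\<open>D\<close> part, so \<open>I\<close> has at least as many leading exponents in each degree as the ideal
  \<open>\<langle>(f\<^sub>1)\<^sub>p, \<dots>\<rangle>\<close> (\<open>card_exponents_mod_le\<close>). The latter has exactly the leading exponents of
  \<open>H = \<langle>G\<rangle>\<close>, because both sets are generated by \<open>exp(G)\<close>, and \<open>I \<subseteq> H\<close> gives the opposite inequality.
  As the weights are positive, each degree contains finitely many exponents, hence \<open>exp(I) = exp(H)\<close>.
  Cancelling leading terms then yields \<open>H \<subseteq> I\<close> (\<open>left_ideal_subset_if_exponents_subset\<close>), so \<open>I = H\<close>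
  has \<open>G\<close> as a Groebner basis.

  For these counts, leading exponents must be read off from a unique standard representative, in
  characteristic zero and modulo \<open>p\<close>. In characteristic zero this is Bergman's diamond lemma, which is
  proved here in a dual form (\<open>compatible_functional_exists\<close>): any values on the
  sorted words extend to a linear functional on the free algebra that vanishes on the ideal of
  relations. The functionals that pick out a single standard monomial are the coordinates of the
  algebra. With integral relations they take integral values on words, so that reducing these
  values modulo \<open>p\<close> gives coordinates for \<open>A\<^sub>p\<close> at once (\<open>coordinates_mod\<close>), and these
  commute with reduction by construction.
\<close>

abbreviation coeff_at :: "('a \<Rightarrow>\<^sub>0 'b::zero) \<Rightarrow> 'a \<Rightarrow> 'b" where
  "coeff_at \<equiv> Poly_Mapping.lookup"

abbreviation word_mono :: "'n fword \<Rightarrow> ('n, 'k::field) free_poly" where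
  "word_mono w \<equiv> Poly_Mapping.single w 1"

section \<open>Linear functionals on the free algebra\<close>

text \<open>
  A functional on the free algebra is given by arbitrary values \<open>\<phi>\<close> on words. Keeping \<open>\<phi>\<close> and its
  linear extension apart allows \<open>\<phi>\<close> to be constructed by recursion over words.
\<close>
definition lin_ext :: "('w \<Rightarrow> 'k::field) \<Rightarrow> ('w \<Rightarrow>\<^sub>0 'k) \<Rightarrow> 'k" where
  "lin_ext \<phi> f = (\<Sum>w\<in>Poly_Mapping.keys f. coeff_at f w * \<phi> w)"

lemma lin_ext_superset:
  assumes "finite S" "Poly_Mapping.keys f \<subseteq> S"
  shows "lin_ext \<phi> f = (\<Sum>w\<in>S. coeff_at f w * \<phi> w)"
  unfolding lin_ext_def by (rule sum.mono_neutral_left) (use assms in \<open>auto simp: in_keys_iff\<close>)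

lemma lin_ext_zero [simp]: "lin_ext \<phi> 0 = 0"
  by (simp add: lin_ext_def)

lemma lin_ext_add: "lin_ext \<phi> (f + g) = lin_ext \<phi> f + lin_ext \<phi> g"
proof -
  let ?S = "Poly_Mapping.keys f \<union> Poly_Mapping.keys g"
  show ?thesis
    using lin_ext_superset[of ?S f \<phi>] lin_ext_superset[of ?S g \<phi>] lin_ext_superset[of ?S "f + g" \<phi>]
      Poly_Mapping.keys_add[of f g]
    by (simp add: lookup_add algebra_simps sum.distrib)
qed

lemma lin_ext_uminus: "lin_ext \<phi> (- f) = - lin_ext \<phi> f"
  using lin_ext_add[of \<phi> f "- f"] by (simp add: eq_neg_iff_add_eq_0 add.commute)

lemma lin_ext_diff: "lin_ext \<phi> (f - g) = lin_ext \<phi> f - lin_ext \<phi> g"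
  using lin_ext_add[of \<phi> f "- g"] by (simp add: lin_ext_uminus)

lemma lin_ext_sum: "lin_ext \<phi> (sum f S) = (\<Sum>x\<in>S. lin_ext \<phi> (f x))"
  by (induction S rule: infinite_finite_induct) (auto simp: lin_ext_add)

lemma lin_ext_single [simp]: "lin_ext \<phi> (Poly_Mapping.single w a) = a * \<phi> w"
  by (simp add: lin_ext_def)

lemma lin_ext_cong: "(\<And>w. w \<in> Poly_Mapping.keys f \<Longrightarrow> \<phi> w = \<psi> w) \<Longrightarrow> lin_ext \<phi> f = lin_ext \<psi> f"
  unfolding lin_ext_def by (rule sum.cong) auto

lemma poly_mapping_decompose: "f = (\<Sum>w\<in>Poly_Mapping.keys f. Poly_Mapping.single w (coeff_at f w))"
proof (rule poly_mapping_eqI)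
  fix k
  show "coeff_at f k
      = coeff_at (\<Sum>w\<in>Poly_Mapping.keys f. Poly_Mapping.single w (coeff_at f w)) k"
    by (cases "k \<in> Poly_Mapping.keys f")
      (auto simp: lookup_sum lookup_single when_def in_keys_iff if_distrib sum.delta cong: if_cong)
qed

lemma lin_ext_mult_single:
  "lin_ext \<phi> (Poly_Mapping.single u a * g) = a * lin_ext (\<lambda>v. \<phi> (u + v)) g"
proof -
  have "Poly_Mapping.single u a * g
      = (\<Sum>v\<in>Poly_Mapping.keys g. Poly_Mapping.single (u + v) (a * coeff_at g v))"
    by (subst (1) poly_mapping_decompose[of g]) (simp add: sum_distrib_left mult_single)
  then show ?thesis
    by (simp add: lin_ext_sum) (simp add: lin_ext_def sum_distrib_left mult_ac)
qed

text \<open>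
  A functional on a product is a nested functional on the factors; fixing one factor this way
  turns multiplication by words into a shift of \<open>\<phi>\<close>.
\<close>
lemma lin_ext_mult: "lin_ext \<phi> (f * g) = lin_ext (\<lambda>u. lin_ext (\<lambda>v. \<phi> (u + v)) g) f"
proof -
  have "f * g = (\<Sum>u\<in>Poly_Mapping.keys f. Poly_Mapping.single u (coeff_at f u) * g)"
    by (subst (1) poly_mapping_decompose[of f]) (simp add: sum_distrib_right)
  then show ?thesis
    by (simp add: lin_ext_sum lin_ext_mult_single) (simp add: lin_ext_def)
qed

lemma const_commute: "f * const a = const a * f"
proof -
  have "Poly_Mapping.single w b * const a = const a * Poly_Mapping.single w b" for w :: "'a fword" and b
    by (simp add: const_def mult_single mult.commute)
  then show ?thesis
    by (subst (1 2) poly_mapping_decompose[of f])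
      (simp only: sum_distrib_left sum_distrib_right)
qed

lemma const_left_commute: "f * (const a * g) = const a * (f * g)"
  by (metis const_commute mult.assoc)

lemma const_mult: "const a * const b = const (a * b)"
  by (simp add: const_def mult_single)

lemma const_mult_left: "const a * (const b * f) = const (a * b) * f"
  by (metis const_mult mult.assoc)

lemma lin_ext_const_mult: "lin_ext \<phi> (const a * f) = a * lin_ext \<phi> f"
  by (simp add: const_def lin_ext_mult_single)

section \<open>Words and their contents\<close>

definition expo_of :: "'n fword \<Rightarrow> 'n expo" where
  "expo_of w = sum_list (map unit_expo (letters w))"

lemma expo_of_plus [simp]: "expo_of (v + w) = expo_of v + expo_of w"
  by (simp add: expo_of_def plus_fword_def)

lemma expo_of_Word: "expo_of (Word [i, j]) = unit_expo i + unit_expo j" "expo_of (Word [i]) = unit_expo i"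
  by (simp_all add: expo_of_def)

lemma lookup_expo_of: "coeff_at (expo_of w) i = count_list (letters w) i"
proof -
  have "coeff_at (sum_list (map unit_expo xs)) i = count_list xs i" for xs
    by (induction xs) (auto simp: lookup_add unit_expo_def lookup_single)
  then show ?thesis by (simp add: expo_of_def)
qed

lemma sorted_std_word:
  fixes \<alpha> :: "'n::{finite,linorder} expo"
  shows "sorted (letters (std_word \<alpha>))"
proof -
  have "sorted (concat (map (\<lambda>i. replicate (f i) i) xs))" if "sorted xs" for f and xs :: "'n list"
    using that by (induction xs) (auto simp: sorted_append)
  then show ?thesis by (simp add: std_word_def)
qed

lemma expo_of_std_word [simp]:
  fixes \<alpha> :: "'n::{finite,linorder} expo"
  shows "expo_of (std_word \<alpha>) = \<alpha>"
proof (rule poly_mapping_eqI)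
  fix k :: 'n
  have count_replicate: "count_list (replicate m i) k = (if i = k then m else 0)" for m i
    by (induction m) auto
  have "count_list (concat (map (\<lambda>i. replicate (f i) i) xs)) k = (if k \<in> set xs then f k else 0)"
    if "distinct xs" for f and xs :: "'n list"
    using that by (induction xs) (auto simp: count_replicate)
  then show "coeff_at (expo_of (std_word \<alpha>)) k = coeff_at \<alpha> k"
    by (simp add: lookup_expo_of std_word_def)
qed

lemma std_word_inject [simp]: "std_word \<alpha> = std_word \<beta> \<longleftrightarrow> \<alpha> = \<beta>"
  by (metis expo_of_std_word)

text \<open>
  A sorted word is determined by how often each letter occurs, so the irreducible words are
  exactly the standard monomials.
\<close>
lemma sorted_word_eq:
  assumes "sorted (letters w)"
  shows "w = std_word (expo_of w)"
proof -
  have "count_list (letters w) = count_list (letters (std_word (expo_of w)))"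
    by (metis ext expo_of_std_word lookup_expo_of)
  then have "mset (letters w) = mset (letters (std_word (expo_of w)))"
    by (intro multiset_eqI) (metis count_mset)
  then have "letters w = letters (std_word (expo_of w))"
    using assms sorted_std_word by (metis properties_for_sort)
  then show ?thesis by (rule fword.expand)
qed

lemma unsorted_word_descent:
  fixes w :: "'n::linorder fword"
  assumes "\<not> sorted (letters w)"
  shows "\<exists>u i j v. i < j \<and> w = u + Word [j, i] + v"
proof -
  from assms obtain k where k: "Suc k < length (letters w)" "letters w ! Suc k < letters w ! k"
    by (auto simp: sorted_iff_nth_Suc not_le)
  have "letters w = take k (letters w) @ [letters w ! k, letters w ! Suc k] @ drop (Suc (Suc k)) (letters w)"
    using k(1) by (simp add: id_take_nth_drop[symmetric] Cons_nth_drop_Suc)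
  then have "w = Word (take k (letters w)) + Word [letters w ! k, letters w ! Suc k]
      + Word (drop (Suc (Suc k)) (letters w))"
    by (simp add: plus_fword_def fword.expand)
  then show ?thesis using k(2) by blast
qed

lemma descent_not_sorted:
  "(i::'n::linorder) < j \<Longrightarrow> \<not> sorted (letters (u + Word [j, i] + v))"
  by (auto simp: plus_fword_def sorted_append)

text \<open>
  Applying a relation to \<open>u x\<^sub>j x\<^sub>i v\<close> yields the swapped word, which has the same exponent vector but
  comes earlier lexicographically, and words from \<open>d\<^sub>i\<^sub>j\<close>, which have a smaller exponent vector.
  This order makes both kinds of words smaller.
\<close>
definition word_less ::
  "('n expo \<Rightarrow> 'n expo \<Rightarrow> bool) \<Rightarrow> ('n::{finite,linorder} fword \<times> 'n fword) set" where
  "word_less lt = {(v, w). lt (expo_of v) (expo_of w) \<or>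
     expo_of v = expo_of w \<and> (letters v, letters w) \<in> lex {(a, b). a < b}}"

lemma wf_word_less:
  assumes "monomial_ordering lt"
  shows "wf (word_less lt)"
proof -
  have "wf {(\<alpha>, \<beta>). lt \<alpha> \<beta>}"
    using assms by (simp add: monomial_ordering_def wfp_def)
  moreover have "wf (lex {(a::'a, b). a < b})"
    by (intro wf_lex wf_subset[OF wf_measure[of "\<lambda>a. card {..<a}"]])
      (auto intro!: psubset_card_mono)
  ultimately have "wf ({(\<alpha>, \<beta>). lt \<alpha> \<beta>} <*lex*> lex {(a::'a, b). a < b})"
    by (rule wf_lex_prod)
  then have "wf (inv_image ({(\<alpha>, \<beta>). lt \<alpha> \<beta>} <*lex*> lex {(a::'a, b). a < b})
      (\<lambda>w. (expo_of w, letters w)))"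
    by (rule wf_inv_image)
  then show ?thesis
    by (rule wf_subset) (auto simp: word_less_def)
qed

lemma trans_word_less:
  assumes "monomial_ordering lt"
  shows "trans (word_less lt)"
proof -
  have *: "lt a b \<Longrightarrow> lt b c \<Longrightarrow> lt a c" for a b c
    using assms by (auto simp: monomial_ordering_def transp_def)
  have "trans (lex {(a::'a, b). a < b})"
    by (rule lex_transI) (auto simp: trans_def)
  then show ?thesis
    unfolding word_less_def trans_def by (auto dest: *)
qed

lemma word_less_swap:
  assumes "i < j"
  shows "(u + Word [i, j] + v, u + Word [j, i] + v) \<in> word_less lt"
proof -
  have "(xs @ i # j # ys, xs @ j # i # ys) \<in> lex {(a, b). a < b}" for xs ys
    using assms by (induction xs) auto
  then show ?thesis
    by (simp add: word_less_def expo_of_Word add_ac) (simp add: plus_fword_def)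
qed

lemma word_less_expo:
  assumes "monomial_ordering lt" "lt (expo_of s) (expo_of t)"
  shows "(u + s + v, u + t + v) \<in> word_less lt"
proof -
  have "lt (expo_of s + (expo_of u + expo_of v)) (expo_of t + (expo_of u + expo_of v))"
    using assms by (auto simp: monomial_ordering_def)
  then show ?thesis by (simp add: word_less_def add_ac)
qed

section \<open>The diamond lemma for G-algebras\<close>

text \<open>
  The value that \<open>\<phi>\<close> takes, by linear extension, on the word \<open>u x\<^sub>j x\<^sub>i v\<close> after its factor \<open>x\<^sub>j x\<^sub>i\<close> has been
  replaced by \<open>c\<^sub>i\<^sub>j x\<^sub>i x\<^sub>j + d\<^sub>i\<^sub>j\<close>.
\<close>
definition reduct ::
  "('n, 'k::field) coeffs \<Rightarrow> ('n, 'k) tails \<Rightarrow> ('n fword \<Rightarrow> 'k) \<Rightarrow>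
   'n fword \<Rightarrow> 'n \<Rightarrow> 'n \<Rightarrow> 'n fword \<Rightarrow> 'k" where
  "reduct c d \<phi> u i j v =
     c i j * \<phi> (u + Word [i, j] + v) + lin_ext (\<lambda>w. \<phi> (u + w + v)) (d i j)"

definition compatible ::
  "('n::linorder, 'k::field) coeffs \<Rightarrow> ('n, 'k) tails \<Rightarrow> ('n fword \<Rightarrow> 'k) \<Rightarrow> bool" where
  "compatible c d \<phi> \<longleftrightarrow> (\<forall>u i j v. i < j \<longrightarrow> \<phi> (u + Word [j, i] + v) = reduct c d \<phi> u i j v)"

text \<open>
  Admissibility as it is used by rewriting. A condition on each word of the tails, rather than on
  their leading exponents, passes to the tails modulo a prime because no new words appear there.
\<close>
definition small_tails ::
  "('n expo \<Rightarrow> 'n expo \<Rightarrow> bool) \<Rightarrow> ('n::linorder, 'k::field) tails \<Rightarrow> bool" where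
  "small_tails lt d \<longleftrightarrow>
     (\<forall>i j. i < j \<longrightarrow> (\<forall>w\<in>Poly_Mapping.keys (d i j). lt (expo_of w) (unit_expo i + unit_expo j)))"

text \<open>
  Termination of rewriting as an induction principle: a property of words may be proved from its
  validity on the words produced by one application of a relation.
\<close>
lemma word_reduction_induct:
  fixes d :: "('n::{finite,linorder}, 'k::field) tails"
  assumes mo: "monomial_ordering lt" and tails: "small_tails lt d"
    and sorted: "\<And>w. sorted (letters w) \<Longrightarrow> P w"
    and descent: "\<And>u i j v. i < j \<Longrightarrow> P (u + Word [i, j] + v)
      \<Longrightarrow> (\<And>s. s \<in> Poly_Mapping.keys (d i j) \<Longrightarrow> P (u + s + v)) \<Longrightarrow> P (u + Word [j, i] + v)"
  shows "P w"
proof (induction w rule: wf_induct_rule[OF wf_word_less[OF mo]])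
  case (1 w)
  show ?case
  proof (cases "sorted (letters w)")
    case False
    then obtain u i j v where ij: "i < j" and w: "w = u + Word [j, i] + v"
      using unsorted_word_descent by blast
    have "P (u + Word [i, j] + v)"
      by (rule 1) (simp only: w word_less_swap[OF ij])
    moreover have "P (u + s + v)" if "s \<in> Poly_Mapping.keys (d i j)" for s
      using tails ij that by (intro 1) (auto intro!: word_less_expo[OF mo]
          simp: w small_tails_def expo_of_Word add.commute)
    ultimately show ?thesis
      unfolding w by (rule descent[OF ij])
  qed (rule sorted)
qed

lemma Word_append: "Word xs + Word ys = Word (xs @ ys)"
  by (simp add: plus_fword_def)

lemma X_mult_X: "X j * X i = word_mono (Word [j, i])"
  by (simp add: X_def mult_single Word_append)

lemma const_mult_X_mult_X: "const a * X i * X j = Poly_Mapping.single (Word [i, j]) a"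
  by (simp add: X_def const_def mult_single Word_append)

lemma lin_ext_mult_X: "lin_ext \<phi> (f * X k) = lin_ext (\<lambda>w. \<phi> (w + Word [k])) f"
  by (simp add: lin_ext_mult X_def)

lemma lin_ext_X_mult: "lin_ext \<phi> (X k * f) = lin_ext (\<lambda>w. \<phi> (Word [k] + w)) f"
  by (simp add: lin_ext_mult X_def)

lemma lin_ext_rel_rhs: "lin_ext \<phi> (rel_rhs c d i j) = c i j * \<phi> (Word [i, j]) + lin_ext \<phi> (d i j)"
  by (simp add: rel_rhs_def const_mult_X_mult_X lin_ext_add)

lemma lin_ext_relator:
  "lin_ext (\<lambda>w. \<phi> (u + w + v)) (X j * X i - rel_rhs c d i j)
     = \<phi> (u + Word [j, i] + v) - reduct c d \<phi> u i j v"
  by (simp add: lin_ext_diff X_mult_X lin_ext_rel_rhs reduct_def)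

lemma lin_ext_fun_add: "lin_ext (\<lambda>w. \<phi> w + \<psi> w) f = lin_ext \<phi> f + lin_ext \<psi> f"
  by (simp add: lin_ext_def algebra_simps sum.distrib)

lemma lin_ext_fun_scale: "lin_ext (\<lambda>w. a * \<phi> w) f = a * lin_ext \<phi> f"
  by (simp add: lin_ext_def sum_distrib_left mult_ac)

lemma lin_ext_swap: "lin_ext (\<lambda>s. lin_ext (\<lambda>t. \<phi> s t) g) f = lin_ext (\<lambda>t. lin_ext (\<lambda>s. \<phi> s t) f) g"
  unfolding lin_ext_def sum_distrib_left by (subst sum.swap) (simp add: mult_ac)

text \<open>
  The only overlaps of left-hand sides are the words \<open>x\<^sub>k x\<^sub>j x\<^sub>i\<close>. Rewriting the two results further,
  down to the word \<open>x\<^sub>i x\<^sub>j x\<^sub>k\<close>, leaves the element of the non-degeneracy condition; every intermediate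
  use of a relation occurs at a word that is smaller than \<open>x\<^sub>k x\<^sub>j x\<^sub>i\<close>.
\<close>
lemma overlap_identity:
  "rel_rhs c d j k * X i - X k * rel_rhs c d i j
     = nondeg c d i j k
       + const (c j k) * (X j * (X k * X i - rel_rhs c d i k))
       + const (c j k * c i k) * ((X j * X i - rel_rhs c d i j) * X k)
       - const (c i j) * ((X k * X i - rel_rhs c d i k) * X j)
       - const (c i j * c i k) * (X i * (X k * X j - rel_rhs c d j k))"
  unfolding rel_rhs_def nondeg_def
  by (simp add: algebra_simps const_commute[of "X _"] const_commute[of "d _ _"]
      const_left_commute[of "X _"] const_left_commute[of "d _ _"] const_mult const_mult_left)

text \<open>
  The support of \<open>f\<close> lies strictly below \<open>\<beta>\<close>. All words met when the non-degeneracy element is reduced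
  to zero are of this kind, with \<open>\<beta>\<close> the exponent of \<open>x\<^sub>i x\<^sub>j x\<^sub>k\<close>.
\<close>
definition below ::
  "('n expo \<Rightarrow> 'n expo \<Rightarrow> bool) \<Rightarrow> 'n expo \<Rightarrow> ('n, 'k::field) free_poly \<Rightarrow> bool" where
  "below lt \<beta> f \<longleftrightarrow> (\<forall>w\<in>Poly_Mapping.keys f. lt (expo_of w) \<beta>)"

lemma below_add: "below lt \<beta> f \<Longrightarrow> below lt \<beta> g \<Longrightarrow> below lt \<beta> (f + g)"
  using Poly_Mapping.keys_add[of f g] by (auto simp: below_def)

lemma below_diff: "below lt \<beta> f \<Longrightarrow> below lt \<beta> g \<Longrightarrow> below lt \<beta> (f - g)"
  by (auto simp: below_def in_keys_iff lookup_minus)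

lemma below_const_mult: "below lt \<beta> f \<Longrightarrow> below lt \<beta> (const a * f)"
  using keys_mult[of "const a" f] by (fastforce simp: below_def const_def split: if_splits)

lemma below_X_mult:
  assumes "monomial_ordering lt" "below lt \<beta> f"
  shows "below lt (unit_expo k + \<beta>) (X k * f)" "below lt (\<beta> + unit_expo k) (f * X k)"
proof -
  have shift: "lt x y \<Longrightarrow> lt (x + z) (y + z)" for x y z
    using assms(1) by (simp add: monomial_ordering_def)
  have *: "lt (unit_expo k + expo_of w) (unit_expo k + \<beta>)" if "w \<in> Poly_Mapping.keys f" for w
    using shift[of "expo_of w" \<beta> "unit_expo k"] assms(2) that by (simp add: below_def add.commute)
  show "below lt (unit_expo k + \<beta>) (X k * f)"
    unfolding below_def
  proof
    fix w assume "w \<in> Poly_Mapping.keys (X k * f)"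
    then obtain v where "v \<in> Poly_Mapping.keys f" "w = Word [k] + v"
      using keys_mult[of "X k" f] by (auto simp: X_def)
    then show "lt (expo_of w) (unit_expo k + \<beta>)"
      using * by (simp add: expo_of_Word)
  qed
  show "below lt (\<beta> + unit_expo k) (f * X k)"
    unfolding below_def
  proof
    fix w assume "w \<in> Poly_Mapping.keys (f * X k)"
    then obtain v where "v \<in> Poly_Mapping.keys f" "w = v + Word [k]"
      using keys_mult[of f "X k"] by (auto simp: X_def)
    then show "lt (expo_of w) (\<beta> + unit_expo k)"
      using * by (simp add: expo_of_Word add.commute)
  qed
qed

lemma below_nondeg:
  assumes "monomial_ordering lt" "small_tails lt d" "i < j" "j < k"
  shows "below lt (unit_expo i + unit_expo j + unit_expo k) (nondeg c d i j k)"
proof -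
  let ?\<beta> = "unit_expo i + unit_expo j + unit_expo k"
  have *: "below lt ?\<beta> (X e * d a b)" "below lt ?\<beta> (d a b * X e)"
    if "a < b" and \<beta>: "unit_expo a + unit_expo b + unit_expo e = ?\<beta>" for a b e
  proof -
    have "below lt (unit_expo a + unit_expo b) (d a b)"
      using assms(2) that by (simp add: small_tails_def below_def)
    from below_X_mult[OF assms(1) this, of e]
    show "below lt ?\<beta> (X e * d a b)" "below lt ?\<beta> (d a b * X e)"
      unfolding \<beta>[symmetric] by (simp_all only: add.commute)
  qed
  show ?thesis
    unfolding nondeg_def mult.assoc
    using assms(3,4) by (intro below_add below_diff below_const_mult *) (simp_all add: add_ac)
qed

text \<open>
  A functional that obeys the relations at words below \<open>\<beta>\<close> cannot distinguish a polynomial below \<open>\<beta>\<close>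
  from its reduction, and reduction never leaves this region. The restriction to small words is
  what makes this usable inside the induction that establishes the relations at all words.
\<close>
lemma reduction_step_invariant:
  assumes mo: "monomial_ordering lt" and tails: "small_tails lt d"
    and rule: "\<And>u i j v. i < j \<Longrightarrow> lt (expo_of (u + Word [j, i] + v)) \<beta>
      \<Longrightarrow> \<phi> (u + Word [j, i] + v) = reduct c d \<phi> u i j v"
    and step: "reduction_step c d f g" and f: "below lt \<beta> f"
  shows "lin_ext \<phi> g = lin_ext \<phi> f" "below lt \<beta> g"
proof -
  obtain i j u v a where ij: "i < j" and key: "coeff_at f (u + Word [j, i] + v) \<noteq> 0"
    and g: "g = f - Poly_Mapping.single u a * (X j * X i - rel_rhs c d i j) * word_mono v"
    using step unfolding reduction_step_def by blast
  have lt_top: "lt (expo_of (u + Word [j, i] + v)) \<beta>"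
    using f key unfolding below_def by (blast intro: lookup_not_eq_zero_eq_in_keys[THEN iffD1])
  have "lin_ext \<phi> (Poly_Mapping.single u a * (X j * X i - rel_rhs c d i j) * word_mono v)
      = a * lin_ext (\<lambda>w. \<phi> (u + w + v)) (X j * X i - rel_rhs c d i j)"
    by (simp add: lin_ext_mult mult.assoc lin_ext_mult_single add.assoc)
  then show "lin_ext \<phi> g = lin_ext \<phi> f"
    using rule[OF ij lt_top] by (simp add: g lin_ext_diff[of \<phi> f] lin_ext_relator)
  have trans: "lt x y \<Longrightarrow> lt y z \<Longrightarrow> lt x z" and shift: "lt x y \<Longrightarrow> lt (x + z) (y + z)" for x y z
    using mo by (auto simp: monomial_ordering_def transp_def)
  have "lt (expo_of w) \<beta>"
    if w: "w \<in> Poly_Mapping.keys (Poly_Mapping.single u a * (X j * X i - rel_rhs c d i j) * word_mono v)"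
    for w
  proof -
    obtain s where s: "s \<in> Poly_Mapping.keys (X j * X i - rel_rhs c d i j)" and ws: "w = u + s + v"
      using keys_mult[of "Poly_Mapping.single u a * (X j * X i - rel_rhs c d i j)" "word_mono v"]
        keys_mult[of "Poly_Mapping.single u a" "X j * X i - rel_rhs c d i j"] w
      by (fastforce split: if_splits)
    have "s = Word [j, i] \<or> s = Word [i, j] \<or> s \<in> Poly_Mapping.keys (d i j)"
      using s by (auto simp: rel_rhs_def X_mult_X const_mult_X_mult_X in_keys_iff lookup_minus
          lookup_add lookup_single when_def split: if_splits)
    then have "expo_of s = expo_of (Word [j, i]) \<or> lt (expo_of s) (expo_of (Word [j, i]))"
      using tails ij by (auto simp: small_tails_def expo_of_Word add.commute)
    then show ?thesis
    proof
      assume "expo_of s = expo_of (Word [j, i])"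
      then show ?thesis using lt_top by (simp add: ws)
    next
      assume "lt (expo_of s) (expo_of (Word [j, i]))"
      from shift[OF this, of "expo_of u + expo_of v"] show ?thesis
        using lt_top by (intro trans[OF _ lt_top]) (simp add: ws add_ac)
    qed
  qed
  then show "below lt \<beta> g"
    unfolding g using f by (intro below_diff) (auto simp: below_def)
qed

lemma lin_ext_reduces_to_zero:
  assumes "monomial_ordering lt" "small_tails lt d"
    and "\<And>u i j v. i < j \<Longrightarrow> lt (expo_of (u + Word [j, i] + v)) \<beta>
      \<Longrightarrow> \<phi> (u + Word [j, i] + v) = reduct c d \<phi> u i j v"
    and "reduces_to_zero c d f" "below lt \<beta> f"
  shows "lin_ext \<phi> f = 0"
proof -
  have "(reduction_step c d)\<^sup>*\<^sup>* f 0"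
    using assms(4) by (simp add: reduces_to_zero_def)
  then have "lin_ext \<phi> 0 = lin_ext \<phi> f \<and> below lt \<beta> (0 :: ('a, 'b) free_poly)"
    using assms(5)
  proof (induction rule: rtranclp_induct)
    case (step g h)
    then show ?case
      using reduction_step_invariant[OF assms(1-3) step.hyps(2)] by metis
  qed simp
  then show ?thesis by simp
qed

text \<open>
  Bergman's argument at a word \<open>w\<close> with two descents, for a functional that obeys the relations at all
  smaller words. If the descents are disjoint, both results can be rewritten at the other
  descent, and they meet. If they overlap in \<open>x\<^sub>k x\<^sub>j x\<^sub>i\<close>, their difference is a combination of relations
  at smaller words and of the non-degeneracy element, which reduces to zero.
\<close>
lemma descents_confluent:
  fixes c :: "('n::{finite,linorder}, 'k::field) coeffs"
  assumes mo: "monomial_ordering lt" and tails: "small_tails lt d"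
    and nd: "\<And>i j k. i < j \<Longrightarrow> j < k \<Longrightarrow> reduces_to_zero c d (nondeg c d i j k)"
    and IH: "\<And>u i j v. i < j \<Longrightarrow> (u + Word [j, i] + v, w) \<in> word_less lt
      \<Longrightarrow> \<phi> (u + Word [j, i] + v) = reduct c d \<phi> u i j v"
    and w: "w = u + Word [j, i] + v" "w = u' + Word [j', i'] + v'"
    and ij: "i < j" "i' < j'"
    and len: "length (letters u) \<le> length (letters u')"
  shows "reduct c d \<phi> u i j v = reduct c d \<phi> u' i' j' v'"
proof -
  have eq: "letters u @ [j, i] @ letters v = letters u' @ [j', i'] @ letters v'"
    using w by (metis append.assoc fword.sel plus_fword_def)
  define m where "m = drop (length (letters u)) (letters u')"
  have m: "letters u' = letters u @ m"
    using eq len unfolding m_def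
    by (metis append_eq_append_conv_if append_take_drop_id)
  then have u': "u' = u + Word m"
    by (simp add: plus_fword_def fword.expand)
  from eq m have eq': "[j, i] @ letters v = m @ [j', i'] @ letters v'"
    by simp
  consider "m = []" | "m = [j]" | m' where "m = j # i # m'"
    using eq' by (cases m; cases "tl m") auto
  then show ?thesis
  proof cases
    (* both descents are at the same position *)
    case 1
    with eq' have "j = j'" "i = i'" "v = v'" by (auto intro: fword.expand)
    with 1 u' show ?thesis by (simp add: zero_fword_def[symmetric])
  next
    (* the letters j > i = j' > i' are consecutive in w *)
    case 2
    with eq' have i: "i = j'" and "letters v = i' # letters v'" by auto
    then have v: "v = Word [i'] + v'"
      by (simp add: plus_fword_def fword.expand)
    let ?L = "lin_ext (\<lambda>w. \<phi> (u + w + v'))"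
    let ?r = "\<lambda>i j. X j * X i - rel_rhs c d i j"
    have i'i: "i' < i" and w_eq: "w = u + Word [j, i, i'] + v'" and i'j: "i' < j"
      using i ij w v by (auto simp: plus_fword_def)
    have *: "Word [a, b] + (Word [e] + v') = Word [a, b, e] + v'"
      "Word [a] + (Word [b, e] + v') = Word [a, b, e] + v'" for a b e
      by (simp_all add: plus_fword_def)
    have tr: "(a, b) \<in> word_less lt \<Longrightarrow> (b, e) \<in> word_less lt \<Longrightarrow> (a, e) \<in> word_less lt" for a b e
      using trans_word_less[OF mo] by (auto dest: transD)
    have less1: "(u + Word [i, j, i'] + v', w) \<in> word_less lt"
      using word_less_swap[OF ij(1), of u "Word [i'] + v'"] by (simp add: w_eq * add.assoc)
    have less2: "(u + Word [j, i', i] + v', w) \<in> word_less lt"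
      using word_less_swap[OF i'i, of "u + Word [j]" v'] by (simp add: w_eq * add.assoc)
    have less3: "(u + Word [i, i', j] + v', w) \<in> word_less lt"
      using tr[OF _ less1] word_less_swap[OF i'j, of "u + Word [i]" v'] by (simp add: * add.assoc)
    have less4: "(u + Word [i', j, i] + v', w) \<in> word_less lt"
      using tr[OF _ less2] word_less_swap[OF i'j, of "u" "Word [i] + v'"] by (simp add: * add.assoc)
    have r1: "?L (X i * ?r i' j) = 0"
      using IH[OF i'j, of "u + Word [i]" v'] less1 lin_ext_relator[of \<phi> "u + Word [i]" v' j i' c d]
      by (simp add: lin_ext_X_mult * add.assoc)
    have r2: "?L (?r i' i * X j) = 0"
      using IH[OF i'i, of u "Word [j] + v'"] less3 lin_ext_relator[of \<phi> u "Word [j] + v'" i i' c d]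
      by (simp add: lin_ext_mult_X * add.assoc)
    have r3: "?L (?r i' j * X i) = 0"
      using IH[OF i'j, of u "Word [i] + v'"] less2 lin_ext_relator[of \<phi> u "Word [i] + v'" j i' c d]
      by (simp add: lin_ext_mult_X * add.assoc)
    have r4: "?L (X i' * ?r i j) = 0"
      using IH[OF ij(1), of "u + Word [i']" v'] less4 lin_ext_relator[of \<phi> "u + Word [i']" v' j i c d]
      by (simp add: lin_ext_X_mult * add.assoc)
    have r5: "?L (nondeg c d i' i j) = 0"
    proof (rule lin_ext_reduces_to_zero[OF mo tails])
      show "reduces_to_zero c d (nondeg c d i' i j)" by (rule nd[OF i'i ij(1)])
      show "below lt (unit_expo i' + unit_expo i + unit_expo j) (nondeg c d i' i j)"
        by (rule below_nondeg[OF mo tails i'i ij(1)])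
      fix u1 a b v1
      assume ab: "a < b"
        and lt: "lt (expo_of (u1 + Word [b, a] + v1)) (unit_expo i' + unit_expo i + unit_expo j)"
      have "expo_of (Word [j, i, i']) = unit_expo i' + unit_expo i + unit_expo j"
        by (simp add: expo_of_def add_ac)
      with lt have "(u + (u1 + Word [b, a] + v1) + v', w) \<in> word_less lt"
        unfolding w_eq by (intro word_less_expo[OF mo]) simp
      then show "\<phi> (u + (u1 + Word [b, a] + v1) + v')
          = reduct c d (\<lambda>w. \<phi> (u + w + v')) u1 a b v1"
        using IH[OF ab, of "u + u1" "v1 + v'"] by (simp add: reduct_def add.assoc)
    qed
    have "reduct c d \<phi> u i j v = ?L (rel_rhs c d i j * X i')"
      by (simp add: reduct_def lin_ext_mult_X lin_ext_rel_rhs v add.assoc)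
    moreover have "reduct c d \<phi> u' i' j' v' = ?L (X j * rel_rhs c d i' i)"
      by (simp add: reduct_def lin_ext_X_mult lin_ext_rel_rhs u' 2 i add.assoc)
    moreover have "?L (rel_rhs c d i j * X i' - X j * rel_rhs c d i' i) = 0"
      unfolding overlap_identity by (simp add: lin_ext_add lin_ext_diff lin_ext_const_mult r1 r2 r3 r4 r5)
    ultimately show ?thesis by (simp add: lin_ext_diff)
  next
    (* the descents are separated by the word m' *)
    case 3
    with eq' have "letters v = m' @ [j', i'] @ letters v'" by simp
    then have v: "v = Word m' + Word [j', i'] + v'"
      by (simp add: plus_fword_def fword.expand)
    have u'_eq: "u' = u + Word [j, i] + Word m'"
      using u' 3 by (simp add: plus_fword_def)
    have w_eq: "w = u + Word [j, i] + (Word m' + Word [j', i'] + v')"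
      using w v by (simp add: add.assoc)
    have L: "\<phi> (u + s + (Word m' + Word [j', i'] + v')) = reduct c d \<phi> (u + s + Word m') i' j' v'"
      if "s = Word [i, j] \<or> s \<in> Poly_Mapping.keys (d i j)" for s
    proof -
      have "(u + s + (Word m' + Word [j', i'] + v'), w) \<in> word_less lt"
        using that
      proof
        assume "s = Word [i, j]"
        then show ?thesis unfolding w_eq by (simp only: word_less_swap[OF ij(1)])
      next
        assume "s \<in> Poly_Mapping.keys (d i j)"
        then show ?thesis unfolding w_eq
          using tails ij(1) by (intro word_less_expo[OF mo])
            (auto simp: small_tails_def expo_of_Word add.commute)
      qed
      then show ?thesis
        using IH[OF ij(2), of "u + s + Word m'" v'] by (simp add: add.assoc)
    qed
    have R: "\<phi> (u + Word [j, i] + Word m' + t + v') = reduct c d \<phi> u i j (Word m' + t + v')"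
      if "t = Word [i', j'] \<or> t \<in> Poly_Mapping.keys (d i' j')" for t
    proof -
      have w_eq': "w = u + Word [j, i] + Word m' + Word [j', i'] + v'"
        by (simp add: w_eq add.assoc)
      have "(u + Word [j, i] + Word m' + t + v', w) \<in> word_less lt"
        using that
      proof
        assume "t = Word [i', j']"
        then show ?thesis unfolding w_eq' by (simp only: word_less_swap[OF ij(2)])
      next
        assume "t \<in> Poly_Mapping.keys (d i' j')"
        then show ?thesis unfolding w_eq'
          using tails ij(2) by (intro word_less_expo[OF mo])
            (auto simp: small_tails_def expo_of_Word add.commute)
      qed
      then show ?thesis
        using IH[OF ij(1), of u "Word m' + t + v'"] by (simp add: add.assoc)
    qed
    have "reduct c d \<phi> u i j v = c i j * reduct c d \<phi> (u + Word [i, j] + Word m') i' j' v'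
        + lin_ext (\<lambda>s. reduct c d \<phi> (u + s + Word m') i' j' v') (d i j)"
        unfolding v by (subst reduct_def) (simp add: L cong: lin_ext_cong)
    also have "\<dots> = c i' j' * reduct c d \<phi> u i j (Word m' + Word [i', j'] + v')
        + lin_ext (\<lambda>t. reduct c d \<phi> u i j (Word m' + t + v')) (d i' j')"
      unfolding reduct_def lin_ext_fun_add lin_ext_fun_scale
      using lin_ext_swap[of "\<lambda>s t. \<phi> (u + s + Word m' + t + v')" "d i' j'" "d i j"]
      by (simp add: algebra_simps)
    also have "\<dots> = reduct c d \<phi> u' i' j' v'"
      unfolding u'_eq by (subst (3) reduct_def) (simp add: R cong: lin_ext_cong)
    finally show ?thesis .
  qed
qed

text \<open>
  The diamond lemma in dual form. A functional is defined by well-founded recursion that rewrites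
  an unsorted word at one chosen descent; by confluence every other descent gives the same value.
\<close>
theorem compatible_functional_exists:
  fixes c :: "('n::{finite,linorder}, 'k::field) coeffs" and \<psi> :: "'n expo \<Rightarrow> 'k"
  assumes mo: "monomial_ordering lt" and tails: "small_tails lt d"
    and nd: "\<And>i j k. i < j \<Longrightarrow> j < k \<Longrightarrow> reduces_to_zero c d (nondeg c d i j k)"
  shows "\<exists>\<phi>. compatible c d \<phi> \<and> (\<forall>\<alpha>. \<phi> (std_word \<alpha>) = \<psi> \<alpha>)"
proof -
  define D :: "'n fword \<Rightarrow> 'n fword \<times> 'n \<times> 'n \<times> 'n fword" where
    "D w = (SOME (u, i, j, v). i < j \<and> w = u + Word [j, i] + v)" for w
  define F where "F \<chi> w = (if sorted (letters w) then \<psi> (expo_of w)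
    else case D w of (u, i, j, v) \<Rightarrow> reduct c d \<chi> u i j v)" for \<chi> w
  define \<phi> where "\<phi> = wfrec (word_less lt) F"
  have D_spec: "\<exists>u i j v. D w = (u, i, j, v) \<and> i < j \<and> w = u + Word [j, i] + v"
    if "\<not> sorted (letters w)" for w
  proof -
    from unsorted_word_descent[OF that]
    have "\<exists>x. (case x of (u, i, j, v) \<Rightarrow> i < j \<and> w = u + Word [j, i] + v)" by auto
    from someI_ex[OF this] show ?thesis unfolding D_def by (auto split: prod.splits)
  qed
  have unfold: "\<phi> w = F (cut \<phi> (word_less lt) w) w" for w
    unfolding \<phi>_def by (subst wfrec[OF wf_word_less[OF mo]]) simp
  have std: "\<phi> w = \<psi> (expo_of w)" if "sorted (letters w)" for w
    using unfold[of w] that by (simp add: F_def)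
  have chosen: "\<exists>u i j v. i < j \<and> w = u + Word [j, i] + v \<and> \<phi> w = reduct c d \<phi> u i j v"
    if unsorted: "\<not> sorted (letters w)" for w
  proof -
    obtain u i j v where Dw: "D w = (u, i, j, v)" and ij: "i < j" and w: "w = u + Word [j, i] + v"
      using D_spec[OF unsorted] by blast
    have "(u + Word [i, j] + v, w) \<in> word_less lt"
      unfolding w by (rule word_less_swap[OF ij])
    moreover have "(u + s + v, w) \<in> word_less lt" if "s \<in> Poly_Mapping.keys (d i j)" for s
      unfolding w using tails ij that by (intro word_less_expo[OF mo])
        (auto simp: small_tails_def expo_of_Word add.commute)
    ultimately have "reduct c d (cut \<phi> (word_less lt) w) u i j v = reduct c d \<phi> u i j v"
      unfolding reduct_def by (simp add: cut_apply cong: lin_ext_cong)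
    then show ?thesis
      using unfold[of w] unsorted Dw ij w by (auto simp: F_def)
  qed
  have "i < j \<Longrightarrow> w = u + Word [j, i] + v \<Longrightarrow> \<phi> w = reduct c d \<phi> u i j v" for w u i j v
  proof (induction w arbitrary: u i j v rule: wf_induct_rule[OF wf_word_less[OF mo]])
    case (1 w)
    have "\<not> sorted (letters w)"
      using 1 descent_not_sorted by blast
    from chosen[OF this] obtain u' i' j' v' where
      *: "i' < j'" "w = u' + Word [j', i'] + v'" "\<phi> w = reduct c d \<phi> u' i' j' v'"
      by blast
    have IH: "\<And>u i j v. i < j \<Longrightarrow> (u + Word [j, i] + v, w) \<in> word_less lt
      \<Longrightarrow> \<phi> (u + Word [j, i] + v) = reduct c d \<phi> u i j v"
      using 1 by blast
    have "reduct c d \<phi> u i j v = reduct c d \<phi> u' i' j' v'"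
    proof (cases "length (letters u) \<le> length (letters u')")
      case True
      show ?thesis
        by (rule descents_confluent[OF mo tails _ _ 1(3) *(2) 1(2) *(1) True]) (fact nd, fact IH)
    next
      case False
      then have len: "length (letters u') \<le> length (letters u)" by simp
      show ?thesis
        by (rule descents_confluent[OF mo tails _ _ *(2) 1(3) *(1) 1(2) len, symmetric])
          (fact nd, fact IH)
    qed
    with * show ?case by simp
  qed
  then show ?thesis
    using std by (intro exI[of _ \<phi>]) (auto simp: compatible_def sorted_std_word)
qed

section \<open>Residue classes and left ideals\<close>

abbreviation relation_ideal ::
  "('n::linorder, 'k::field) coeffs \<Rightarrow> ('n, 'k) tails \<Rightarrow> ('n, 'k) free_poly set" where
  "relation_ideal c d \<equiv> Idl\<^bsub>free_alg\<^esub> (relators c d)"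

lemma free_alg_sel [simp]:
  "carrier free_alg = UNIV" "f \<otimes>\<^bsub>free_alg\<^esub> g = f * g" "\<one>\<^bsub>free_alg\<^esub> = 1"
  "\<zero>\<^bsub>free_alg\<^esub> = 0" "f \<oplus>\<^bsub>free_alg\<^esub> g = f + g"
  by (simp_all add: free_alg_def)

lemma ring_free_alg: "ring (free_alg :: ('n, 'k::field) free_poly ring)"
proof (rule ringI)
  show "abelian_group (free_alg :: ('n, 'k) free_poly ring)"
  proof (rule abelian_groupI)
    show "\<exists>y\<in>carrier free_alg. y \<oplus>\<^bsub>free_alg\<^esub> f = \<zero>\<^bsub>free_alg\<^esub>" for f :: "('n, 'k) free_poly"
      by (rule bexI[of _ "- f"]) auto
  qed (auto simp: add_ac)
  show "Group.monoid (free_alg :: ('n, 'k) free_poly ring)"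
    by (rule monoidI) (auto simp: mult.assoc)
qed (auto simp: algebra_simps)

lemma free_alg_uminus [simp]: "\<ominus>\<^bsub>free_alg\<^esub> f = - (f :: ('n, 'k::field) free_poly)"
proof -
  interpret ring "free_alg :: ('n, 'k) free_poly ring" by (rule ring_free_alg)
  show ?thesis by (rule minus_equality) auto
qed

lemma ideal_relation_ideal: "ideal (relation_ideal c d) free_alg"
  by (rule ring.genideal_ideal[OF ring_free_alg]) simp

lemma relation_ideal_closed:
  fixes f g :: "('n::linorder, 'k::field) free_poly"
  shows "0 \<in> relation_ideal c d"
    "f \<in> relation_ideal c d \<Longrightarrow> g \<in> relation_ideal c d \<Longrightarrow> f + g \<in> relation_ideal c d"
    "f \<in> relation_ideal c d \<Longrightarrow> - f \<in> relation_ideal c d"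
    "f \<in> relation_ideal c d \<Longrightarrow> g * f \<in> relation_ideal c d"
    "f \<in> relation_ideal c d \<Longrightarrow> f * g \<in> relation_ideal c d"
proof -
  interpret ideal "relation_ideal c d" "free_alg :: ('n, 'k) free_poly ring"
    by (rule ideal_relation_ideal)
  show "0 \<in> relation_ideal c d"
    using additive_subgroup.zero_closed[OF is_additive_subgroup] by simp
  show "f + g \<in> relation_ideal c d" if "f \<in> relation_ideal c d" "g \<in> relation_ideal c d"
    using additive_subgroup.a_closed[OF is_additive_subgroup that] by simp
  show "- f \<in> relation_ideal c d" if "f \<in> relation_ideal c d"
    using additive_subgroup.a_inv_closed[OF is_additive_subgroup that] by simp
  show "g * f \<in> relation_ideal c d" "f * g \<in> relation_ideal c d" if "f \<in> relation_ideal c d"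
    using I_l_closed[OF that, of g] I_r_closed[OF that, of g] by simp_all
qed

lemma relator_in_relation_ideal: "i < j \<Longrightarrow> X j * X i - rel_rhs c d i j \<in> relation_ideal c d"
  using ring.genideal_self[OF ring_free_alg, of "relators c d"] by (auto simp: relators_def)

lemma residue_class_memb: "f \<in> residue_class c d g \<longleftrightarrow> f - g \<in> relation_ideal c d"
  by (auto simp: residue_class_def a_r_coset_def r_coset_def) (metis diff_add_cancel)

lemma residue_class_eq: "residue_class c d f = residue_class c d g \<longleftrightarrow> f - g \<in> relation_ideal c d"
proof
  assume "residue_class c d f = residue_class c d g"
  then have "f \<in> residue_class c d g"
    using relation_ideal_closed(1) residue_class_memb by (metis diff_self)
  then show "f - g \<in> relation_ideal c d"
    by (simp add: residue_class_memb)
next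
  assume fg: "f - g \<in> relation_ideal c d"
  have "h - f \<in> relation_ideal c d \<longleftrightarrow> h - g \<in> relation_ideal c d" for h
    using relation_ideal_closed(2)[of "h - f" c d "f - g"] fg
      relation_ideal_closed(2)[of "h - g" c d "- (f - g)"] relation_ideal_closed(3)[OF fg] by auto
  then show "residue_class c d f = residue_class c d g"
    by (auto simp: residue_class_memb)
qed

lemma residue_class_eqI: "a = residue_class c d f \<Longrightarrow> g \<in> a \<Longrightarrow> a = residue_class c d g"
  using relation_ideal_closed(3)[of "g - f" c d] by (simp add: residue_class_memb residue_class_eq)

lemma ring_hom_residue_class:
  "ring_hom_ring free_alg (G_alg c d) (residue_class c d)"
  using ideal.rcos_ring_hom_ring[OF ideal_relation_ideal]
  by (simp add: G_alg_def residue_class_def[abs_def])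

lemma carrier_G_alg: "carrier (G_alg c d) = range (residue_class c d)"
  by (auto simp: G_alg_def FactRing_simps residue_class_def a_r_coset_def)

lemma residue_class_hom:
  fixes f g :: "('n::linorder, 'k::field) free_poly"
  shows "residue_class c d (f + g) = residue_class c d f \<oplus>\<^bsub>G_alg c d\<^esub> residue_class c d g"
    "residue_class c d (f * g) = residue_class c d f \<otimes>\<^bsub>G_alg c d\<^esub> residue_class c d g"
    "residue_class c d 0 = \<zero>\<^bsub>G_alg c d\<^esub>"
    "residue_class c d (- f) = \<ominus>\<^bsub>G_alg c d\<^esub> residue_class c d f"
proof -
  interpret ring_hom_ring free_alg "G_alg c d" "residue_class c d"
    by (rule ring_hom_residue_class)
  show "residue_class c d (f + g) = residue_class c d f \<oplus>\<^bsub>G_alg c d\<^esub> residue_class c d g"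
    using hom_add[of f g] by simp
  show "residue_class c d (f * g) = residue_class c d f \<otimes>\<^bsub>G_alg c d\<^esub> residue_class c d g"
    using hom_mult[of f g] by simp
  show "residue_class c d 0 = \<zero>\<^bsub>G_alg c d\<^esub>"
    using hom_zero by simp
  show "residue_class c d (- f) = \<ominus>\<^bsub>G_alg c d\<^esub> residue_class c d f"
    using hom_a_inv[of f] by simp
qed

lemma left_ideal_residue_class:
  assumes L: "left_ideal L (G_alg c d)"
  shows "L \<subseteq> range (residue_class c d)"
    "residue_class c d 0 \<in> L"
    "residue_class c d f \<in> L \<Longrightarrow> residue_class c d g \<in> L \<Longrightarrow> residue_class c d (f + g) \<in> L"
    "residue_class c d f \<in> L \<Longrightarrow> residue_class c d (h * f) \<in> L"
proof -
  interpret additive_subgroup L "G_alg c d" using L by (simp add: left_ideal_def)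
  show "L \<subseteq> range (residue_class c d)" using a_subset by (simp add: carrier_G_alg)
  show "residue_class c d 0 \<in> L" by (simp add: residue_class_hom)
  show "residue_class c d f \<in> L \<Longrightarrow> residue_class c d g \<in> L \<Longrightarrow> residue_class c d (f + g) \<in> L"
    by (simp add: residue_class_hom)
  show "residue_class c d f \<in> L \<Longrightarrow> residue_class c d (h * f) \<in> L"
    using L by (simp add: residue_class_hom left_ideal_def carrier_G_alg)
qed

lemma left_ideal_residue_class_diff:
  assumes "left_ideal L (G_alg c d)" "residue_class c d f \<in> L" "residue_class c d g \<in> L"
  shows "residue_class c d (f - h * g) \<in> L"
  using left_ideal_residue_class(3)[OF assms(1,2) left_ideal_residue_class(4)[OF assms(1,3), of "- h"]]
  by simp

lemma left_ideal_residue_class_sum: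
  assumes L: "left_ideal L (G_alg c d)" and "\<And>t. t \<in> T \<Longrightarrow> residue_class c d (g t) \<in> L"
  shows "residue_class c d (\<Sum>t\<in>T. h t * g t) \<in> L"
  using assms(2)
  by (induction T rule: infinite_finite_induct) (auto intro: left_ideal_residue_class[OF L])

lemma left_idealI_residue_class:
  assumes "0 \<in> S" "\<And>f g. f \<in> S \<Longrightarrow> g \<in> S \<Longrightarrow> f + g \<in> S" "\<And>f h. f \<in> S \<Longrightarrow> h * f \<in> S"
  shows "left_ideal (residue_class c d ` S) (G_alg c d)"
  unfolding left_ideal_def
proof (intro conjI additive_subgroupI ballI)
  interpret ring_hom_ring free_alg "G_alg c d" "residue_class c d"
    by (rule ring_hom_residue_class)
  show "subgroup (residue_class c d ` S) (add_monoid (G_alg c d))"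
  proof (rule S.add.subgroupI)
    show "residue_class c d ` S \<subseteq> carrier (G_alg c d)" by (auto simp: carrier_G_alg)
    show "residue_class c d ` S \<noteq> {}" using assms(1) by auto
    show "a_inv (G_alg c d) a \<in> residue_class c d ` S" if "a \<in> residue_class c d ` S" for a
    proof -
      obtain f where "f \<in> S" "a = residue_class c d f" using \<open>a \<in> _\<close> by blast
      then show ?thesis
        using assms(3)[of f "- 1"] by (auto simp: residue_class_hom(4)[symmetric])
    qed
    show "a \<oplus>\<^bsub>G_alg c d\<^esub> b \<in> residue_class c d ` S"
      if "a \<in> residue_class c d ` S" "b \<in> residue_class c d ` S" for a b
      using that assms(2) by (auto simp: residue_class_hom(1)[symmetric])
  qed
  show "r \<otimes>\<^bsub>G_alg c d\<^esub> x \<in> residue_class c d ` S"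
    if "r \<in> carrier (G_alg c d)" "x \<in> residue_class c d ` S" for r x
    using that assms(3) by (auto simp: carrier_G_alg residue_class_hom(2)[symmetric])
qed

lemma left_ideal_gen_minimal: "left_ideal L R \<Longrightarrow> T \<subseteq> L \<Longrightarrow> left_ideal_gen R T \<subseteq> L"
  by (auto simp: left_ideal_gen_def)

lemma left_ideal_gen_superset: "T \<subseteq> left_ideal_gen R T"
  by (auto simp: left_ideal_gen_def)

lemma left_ideal_left_ideal_gen:
  assumes "T \<subseteq> carrier (G_alg c d)"
  shows "left_ideal (left_ideal_gen (G_alg c d) T) (G_alg c d)"
proof -
  interpret ring_hom_ring free_alg "G_alg c d" "residue_class c d"
    by (rule ring_hom_residue_class)
  have "left_ideal (carrier (G_alg c d)) (G_alg c d)"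
    using left_idealI_residue_class[of UNIV c d] by (simp add: carrier_G_alg)
  then have "{L. left_ideal L (G_alg c d) \<and> T \<subseteq> L} \<noteq> {}" using assms by blast
  then have "subgroup (left_ideal_gen (G_alg c d) T) (add_monoid (G_alg c d))"
    unfolding left_ideal_gen_def
    by (intro S.add.subgroups_Inter) (auto simp: left_ideal_def dest: additive_subgroup.a_subgroup)
  then show ?thesis
    unfolding left_ideal_def
    by (auto intro!: additive_subgroupI simp: left_ideal_gen_def left_ideal_def)
qed

text \<open>
  The generators are indexed by \<open>t\<close> so that one coefficient is attached to each index: distinct
  generators may have equal residue classes after reduction modulo a prime.
\<close>
lemma left_ideal_gen_combination:
  fixes g :: "'t \<Rightarrow> ('n::linorder, 'k::field) free_poly"
  assumes "finite T" "a \<in> left_ideal_gen (G_alg c d) ((\<lambda>t. residue_class c d (g t)) ` T)"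
  shows "\<exists>h. a = residue_class c d (\<Sum>t\<in>T. h t * g t)"
proof -
  define S where "S = range (\<lambda>h. \<Sum>t\<in>T. h t * g t)"
  have "left_ideal (residue_class c d ` S) (G_alg c d)"
  proof (rule left_idealI_residue_class)
    show "0 \<in> S" unfolding S_def by (rule range_eqI[of _ _ "\<lambda>_. 0"]) simp
    fix f assume "f \<in> S"
    then obtain h where f: "f = (\<Sum>t\<in>T. h t * g t)" by (auto simp: S_def)
    show "k * f \<in> S" for k
      unfolding S_def
      by (rule range_eqI[of _ _ "\<lambda>t. k * h t"]) (simp add: f sum_distrib_left mult.assoc)
    fix f' assume "f' \<in> S"
    then obtain h' where f': "f' = (\<Sum>t\<in>T. h' t * g t)" by (auto simp: S_def)
    show "f + f' \<in> S"
      unfolding S_def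
      by (rule range_eqI[of _ _ "\<lambda>t. h t + h' t"]) (simp add: f f' sum.distrib distrib_right)
  qed
  moreover have "(\<lambda>t. residue_class c d (g t)) ` T \<subseteq> residue_class c d ` S"
  proof -
    have "g s \<in> S" if "s \<in> T" for s
      unfolding S_def by (rule range_eqI[of _ _ "\<lambda>t. if t = s then 1 else 0"])
        (use that \<open>finite T\<close> in \<open>simp add: if_distrib[of "\<lambda>x. x * _"] cong: if_cong\<close>)
    then show ?thesis by blast
  qed
  ultimately have "left_ideal_gen (G_alg c d) ((\<lambda>t. residue_class c d (g t)) ` T) \<subseteq> residue_class c d ` S"
    by (rule left_ideal_gen_minimal)
  with assms(2) have "a \<in> residue_class c d ` S" by blast
  then show ?thesis unfolding S_def by blast
qed

section \<open>Standard representatives\<close>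

lemma standard_closed:
  "standard 0" "standard f \<Longrightarrow> standard g \<Longrightarrow> standard (f + g)"
  "standard f \<Longrightarrow> standard (const a * f)"
proof -
  show "standard 0" by (simp add: standard_def)
  show "standard f \<Longrightarrow> standard g \<Longrightarrow> standard (f + g)"
    using Poly_Mapping.keys_add[of f g] by (auto simp: standard_def)
  show "standard f \<Longrightarrow> standard (const a * f)"
    using keys_mult[of "const a" f] by (fastforce simp: standard_def const_def split: if_splits)
qed

text \<open>
  Termination of rewriting makes the standard monomials span. Uniqueness of the representative
  comes from the coordinate functionals below.
\<close>
lemma standard_representative_exists:
  fixes c :: "('n::{finite,linorder}, 'k::field) coeffs"
  assumes mo: "monomial_ordering lt" and tails: "small_tails lt d"
  shows "\<exists>s. standard s \<and> s \<in> residue_class c d f"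
proof -
  define good where "good f \<longleftrightarrow> (\<exists>s. standard s \<and> s - f \<in> relation_ideal c d)" for f
  have good_0: "good 0"
    using standard_closed(1) relation_ideal_closed(1) unfolding good_def by (metis diff_zero)
  have good_add: "good (f + g)" if fg: "good f" "good g" for f g
  proof -
    obtain s t where "standard s" "standard t" "s - f \<in> relation_ideal c d" "t - g \<in> relation_ideal c d"
      using fg by (auto simp: good_def)
    moreover have "(s + t) - (f + g) = (s - f) + (t - g)" by simp
    ultimately show ?thesis
      unfolding good_def using standard_closed(2) relation_ideal_closed(2) by metis
  qed
  have good_const: "good (const a * f)" if f: "good f" for a f
  proof -
    obtain s where "standard s" "s - f \<in> relation_ideal c d"
      using f by (auto simp: good_def)
    moreover have "const a * s - const a * f = const a * (s - f)" by (simp add: right_diff_distrib)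
    ultimately show ?thesis
      unfolding good_def using standard_closed(3) relation_ideal_closed(4) by metis
  qed
  have good_combination: "good (\<Sum>w\<in>S. const (a w) * g w)" if "\<And>w. w \<in> S \<Longrightarrow> good (g w)"
    for S :: "'n fword set" and a g
    using that by (induction S rule: infinite_finite_induct) (auto intro: good_0 good_add good_const)
  have single: "Poly_Mapping.single w a = const a * word_mono w" for w :: "'n fword" and a :: 'k
    by (simp add: const_def mult_single)
  have word: "good (word_mono w)" for w
  proof (induction w rule: word_reduction_induct[OF mo tails, case_names sorted descent])
    case (sorted w)
    have "standard (word_mono w :: ('n, 'k) free_poly)"
      using sorted_word_eq[OF sorted] by (auto simp: standard_def)
    then show ?case
      unfolding good_def using relation_ideal_closed(1) by (metis diff_self)
  next
    case (descent u i j v)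
    let ?r = "word_mono u * rel_rhs c d i j * word_mono v"
    have "word_mono u * d i j * word_mono v
        = (\<Sum>s\<in>Poly_Mapping.keys (d i j). const (coeff_at (d i j) s) * word_mono (u + s + v))"
      by (subst (1) poly_mapping_decompose[of "d i j"])
        (simp add: sum_distrib_left sum_distrib_right mult_single const_def)
    moreover have "word_mono u * (const (c i j) * X i * X j) * word_mono v
        = const (c i j) * word_mono (u + Word [i, j] + v)"
      by (subst const_mult_X_mult_X) (simp add: mult_single const_def)
    ultimately have "?r = const (c i j) * word_mono (u + Word [i, j] + v)
        + (\<Sum>s\<in>Poly_Mapping.keys (d i j). const (coeff_at (d i j) s) * word_mono (u + s + v))"
      by (simp add: rel_rhs_def distrib_left distrib_right)
    then have "good ?r"
      using descent by (simp add: good_add good_const good_combination)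
    then obtain s where s: "standard s" "s - ?r \<in> relation_ideal c d"
      by (auto simp: good_def)
    have "word_mono u * (X j * X i - rel_rhs c d i j) * word_mono v \<in> relation_ideal c d"
      by (intro relation_ideal_closed relator_in_relation_ideal descent)
    then have "?r - word_mono (u + Word [j, i] + v) \<in> relation_ideal c d"
      using relation_ideal_closed(3)[of "word_mono u * (X j * X i - rel_rhs c d i j) * word_mono v" c d]
      by (simp add: right_diff_distrib left_diff_distrib X_mult_X mult_single)
    from relation_ideal_closed(2)[OF s(2) this] s(1) show ?case
      by (auto simp: good_def)
  qed
  have "f = (\<Sum>w\<in>Poly_Mapping.keys f. const (coeff_at f w) * word_mono w)"
    unfolding single[symmetric] by (rule poly_mapping_decompose)
  then have "good f"
    by (rule ssubst) (rule good_combination[OF word])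
  then show ?thesis
    by (simp add: good_def residue_class_memb)
qed

text \<open>
  The polynomials all of whose two-sided multiples are killed by \<open>\<phi>\<close> form a two-sided ideal, and this
  ideal contains the relators.
\<close>
lemma lin_ext_relation_ideal:
  fixes \<phi> :: "'n::linorder fword \<Rightarrow> 'k::field"
  assumes \<phi>: "compatible c d \<phi>" and f: "f \<in> relation_ideal c d"
  shows "lin_ext \<phi> f = 0"
proof -
  define K where "K = {f. \<forall>g h. lin_ext \<phi> (g * f * h) = 0}"
  have "ideal K free_alg"
  proof (rule idealI[OF ring_free_alg])
    interpret ring "free_alg :: ('n, 'k) free_poly ring" by (rule ring_free_alg)
    show "subgroup K (add_monoid free_alg)"
    proof (rule add.subgroupI)
      have "0 \<in> K" by (simp add: K_def)
      then show "K \<noteq> {}" by auto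
      show "\<ominus>\<^bsub>free_alg\<^esub> a \<in> K" if "a \<in> K" for a
        using that by (auto simp: K_def lin_ext_uminus)
      show "a \<oplus>\<^bsub>free_alg\<^esub> b \<in> K" if "a \<in> K" "b \<in> K" for a b
        using that by (auto simp: K_def lin_ext_add distrib_left distrib_right)
    qed simp
    show "x \<otimes>\<^bsub>free_alg\<^esub> a \<in> K" "a \<otimes>\<^bsub>free_alg\<^esub> x \<in> K" if "a \<in> K" for a x
      using that by (auto simp: K_def mult.assoc) (metis mult.assoc)
  qed
  moreover have "relators c d \<subseteq> K"
  proof
    fix r assume "r \<in> relators c d"
    then obtain i j where ij: "i < j" and r: "r = X j * X i - rel_rhs c d i j"
      by (auto simp: relators_def)
    have "lin_ext (\<lambda>w. \<phi> (u + w + v)) r = 0" for u v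
      using \<phi> ij unfolding r lin_ext_relator by (simp add: compatible_def)
    then have "lin_ext \<phi> (g * r * h) = 0" for g h
      by (simp add: lin_ext_mult mult.assoc add.assoc lin_ext_swap[of _ h r]) (simp add: lin_ext_def)
    then show "r \<in> K" by (simp add: K_def)
  qed
  ultimately have "f \<in> K"
    using f ring.genideal_minimal[OF ring_free_alg] by blast
  then have "lin_ext \<phi> (1 * f * 1) = 0" unfolding K_def by blast
  then show ?thesis by simp
qed

section \<open>Leading exponents and coordinates\<close>

lemma monomial_orderingD:
  assumes "monomial_ordering lt"
  shows "\<not> lt \<alpha> \<alpha>" "lt \<alpha> \<beta> \<Longrightarrow> lt \<beta> \<gamma> \<Longrightarrow> lt \<alpha> \<gamma>" "\<alpha> \<noteq> \<beta> \<Longrightarrow> lt \<alpha> \<beta> \<or> lt \<beta> \<alpha>"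
  using assms unfolding monomial_ordering_def
  by (auto simp: irreflp_def dest: transpD totalpD)

lemma monomial_ordering_max:
  assumes mo: "monomial_ordering lt" and S: "finite S" "S \<noteq> {}"
  shows "\<exists>\<alpha>\<in>S. \<forall>\<beta>\<in>S. \<beta> \<noteq> \<alpha> \<longrightarrow> lt \<beta> \<alpha>"
  using S
proof (induction S rule: finite_ne_induct)
  case (insert x F)
  then obtain \<alpha> where \<alpha>: "\<alpha> \<in> F" "\<forall>\<beta>\<in>F. \<beta> \<noteq> \<alpha> \<longrightarrow> lt \<beta> \<alpha>" by blast
  show ?case
  proof (cases "lt x \<alpha>")
    case True
    then show ?thesis using \<alpha> by (intro bexI[of _ \<alpha>]) auto
  next
    case False
    then have "lt \<alpha> x" using monomial_orderingD(3)[OF mo, of x \<alpha>] insert \<alpha> by auto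
    then show ?thesis using \<alpha> monomial_orderingD(2)[OF mo] by (intro bexI[of _ x]) auto
  qed
qed simp

lemma lead_exp_eqI:
  assumes mo: "monomial_ordering lt"
    and "\<alpha> \<in> newton f" "\<And>\<beta>. \<beta> \<in> newton f \<Longrightarrow> \<beta> \<noteq> \<alpha> \<Longrightarrow> lt \<beta> \<alpha>"
  shows "lead_exp lt f = \<alpha>"
  unfolding lead_exp_def
proof (rule the_equality)
  fix \<gamma> assume "\<gamma> \<in> newton f \<and> (\<forall>\<beta>\<in>newton f. \<beta> \<noteq> \<gamma> \<longrightarrow> lt \<beta> \<gamma>)"
  then show "\<gamma> = \<alpha>"
    using assms(3)[of \<gamma>] assms(2) monomial_orderingD(1)[OF mo] monomial_orderingD(2)[OF mo, of \<gamma> \<alpha> \<gamma>]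
    by metis
qed (use assms in auto)

lemma finite_newton: "finite (newton f)"
proof -
  have "std_word ` newton f \<subseteq> Poly_Mapping.keys f"
    by (auto simp: newton_def in_keys_iff)
  then have "finite (std_word ` newton f)" by (rule finite_subset) simp
  then show ?thesis by (rule finite_imageD) (simp add: inj_on_def)
qed

lemma newton_nonempty: "standard f \<Longrightarrow> f \<noteq> 0 \<Longrightarrow> newton f \<noteq> {}"
proof -
  assume f: "standard f" "f \<noteq> 0"
  then obtain w where "coeff_at f w \<noteq> 0" by (metis lookup_zero poly_mapping_eqI)
  moreover from this obtain \<alpha> where "w = std_word \<alpha>"
    using f(1) by (auto simp: standard_def in_keys_iff subset_iff)
  ultimately show "newton f \<noteq> {}" by (auto simp: newton_def)
qed

lemma lead_exp:
  assumes "monomial_ordering lt" "newton f \<noteq> {}"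
  shows "lead_exp lt f \<in> newton f"
    and "\<beta> \<in> newton f \<Longrightarrow> \<beta> \<noteq> lead_exp lt f \<Longrightarrow> lt \<beta> (lead_exp lt f)"
  using monomial_ordering_max[OF assms(1) finite_newton assms(2)] lead_exp_eqI[OF assms(1)] by metis+

lemma small_tails_of_admissible:
  assumes "admissible lt d" and std: "\<And>i j. i < j \<Longrightarrow> standard (d i j)"
  shows "small_tails lt d"
  unfolding small_tails_def
proof (intro allI impI ballI)
  fix i j w assume ij: "(i::'a) < j" and w: "w \<in> Poly_Mapping.keys (d i j)"
  have mo: "monomial_ordering lt" using assms(1) by (simp add: admissible_def)
  obtain \<alpha> where \<alpha>: "w = std_word \<alpha>" using std[OF ij] w by (auto simp: standard_def)
  have "\<alpha> \<in> newton (d i j)" using w by (simp add: \<alpha> newton_def in_keys_iff)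
  then have "\<alpha> = lead_exp lt (d i j) \<or> lt \<alpha> (lead_exp lt (d i j))"
    using lead_exp(2)[OF mo] by blast
  moreover have "lt (lead_exp lt (d i j)) (unit_expo i + unit_expo j)"
    using assms(1) ij w by (cases "d i j = 0") (auto simp: admissible_def)
  ultimately show "lt (expo_of w) (unit_expo i + unit_expo j)"
    using monomial_orderingD(2)[OF mo] by (auto simp: \<alpha>)
qed

definition exponents ::
  "('n expo \<Rightarrow> 'n expo \<Rightarrow> bool) \<Rightarrow> ('n::{finite,linorder}, 'k::field) free_poly set ring \<Rightarrow>
   ('n, 'k) free_poly set set \<Rightarrow> 'n expo set" where
  "exponents lt A L = exp_of lt ` (L - {\<zero>\<^bsub>A\<^esub>})"
text \<open>
  A G-algebra with functionals \<open>N \<beta>\<close> that vanish on the relations and are dual to the standard monomials.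
  Their existence makes the standard monomials linearly independent, and \<open>N \<beta>\<close> reads off the coefficient
  at \<open>\<beta>\<close> from any polynomial that represents an element. The functionals are parameters of the
  locale, since they arise from the diamond lemma over the rationals but by reduction modulo \<open>p\<close>.
\<close>
locale coordinates =
  fixes lt :: "'n::{finite,linorder} expo \<Rightarrow> 'n expo \<Rightarrow> bool"
    and c :: "('n, 'k::field) coeffs" and d :: "('n, 'k) tails"
    and N :: "'n expo \<Rightarrow> 'n fword \<Rightarrow> 'k"
  assumes mo: "monomial_ordering lt" and tails: "small_tails lt d"
    and compat: "compatible c d (N \<beta>)"
    and N_std_word: "N \<beta> (std_word \<gamma>) = (if \<gamma> = \<beta> then 1 else 0)"
begin

abbreviation coord :: "'n expo \<Rightarrow> ('n, 'k) free_poly \<Rightarrow> 'k" where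
  "coord \<beta> \<equiv> lin_ext (N \<beta>)"

abbreviation cls :: "('n, 'k) free_poly \<Rightarrow> ('n, 'k) free_poly set" where
  "cls \<equiv> residue_class c d"

lemma coord_standard:
  assumes "standard s"
  shows "coord \<beta> s = coeff_at s (std_word \<beta>)"
proof -
  have "coord \<beta> s = (\<Sum>w\<in>Poly_Mapping.keys s. if w = std_word \<beta> then coeff_at s w else 0)"
    unfolding lin_ext_def using assms
    by (intro sum.cong) (auto simp: standard_def N_std_word)
  then show ?thesis by (simp add: in_keys_iff)
qed

lemma coord_cong:
  assumes "cls f = cls g"
  shows "coord \<beta> f = coord \<beta> g"
  using lin_ext_relation_ideal[OF compat, of "f - g" \<beta>] assms by (simp add: residue_class_eq lin_ext_diff)

lemma std_repr_cls:
  "standard (std_repr (cls f))" "cls (std_repr (cls f)) = cls f"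
  "coeff_at (std_repr (cls f)) (std_word \<beta>) = coord \<beta> f"
proof -
  obtain s where s: "standard s" "s \<in> cls f"
    using standard_representative_exists[OF mo tails] by blast
  have unique: "t = s" if "standard t \<and> t \<in> cls f" for t
  proof (rule poly_mapping_eqI)
    fix w
    have "cls t = cls s" using that s residue_class_eqI by metis
    then have "coeff_at t (std_word \<beta>) = coeff_at s (std_word \<beta>)" for \<beta>
      using coord_cong coord_standard that s(1) by metis
    then show "coeff_at t w = coeff_at s w"
    proof (cases "w \<in> range std_word")
      case False
      then have "w \<notin> Poly_Mapping.keys t" "w \<notin> Poly_Mapping.keys s"
        using that s(1) unfolding standard_def by blast+
      then show ?thesis by (simp add: in_keys_iff)
    qed auto
  qed
  have eq: "std_repr (cls f) = s"
    unfolding std_repr_def by (rule the_equality) (rule conjI[OF s], rule unique)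
  show cls_s: "cls (std_repr (cls f)) = cls f"
    unfolding eq by (rule residue_class_eqI[OF refl s(2), symmetric])
  show "standard (std_repr (cls f))" by (simp add: eq s)
  show "coeff_at (std_repr (cls f)) (std_word \<beta>) = coord \<beta> f"
    using coord_cong[OF cls_s] coord_standard[OF s(1)] by (simp add: eq)
qed

lemma newton_std_repr: "newton (std_repr (cls f)) = {\<beta>. coord \<beta> f \<noteq> 0}"
  by (simp add: newton_def std_repr_cls)

lemma cls_eq_zero_iff: "cls f = \<zero>\<^bsub>G_alg c d\<^esub> \<longleftrightarrow> (\<forall>\<beta>. coord \<beta> f = 0)"
proof
  assume "cls f = \<zero>\<^bsub>G_alg c d\<^esub>"
  then have "cls f = cls 0" by (simp add: residue_class_hom)
  then show "\<forall>\<beta>. coord \<beta> f = 0" using coord_cong[of f 0] by simp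
next
  assume "\<forall>\<beta>. coord \<beta> f = 0"
  then have "std_repr (cls f) = 0"
    using newton_nonempty[OF std_repr_cls(1)] newton_std_repr by blast
  then show "cls f = \<zero>\<^bsub>G_alg c d\<^esub>"
    using std_repr_cls(2)[of f] by (simp add: residue_class_hom)
qed

lemma exp_of_cls:
  assumes "cls f \<noteq> \<zero>\<^bsub>G_alg c d\<^esub>"
  shows "coord (exp_of lt (cls f)) f \<noteq> 0"
    and "coord \<beta> f \<noteq> 0 \<Longrightarrow> \<beta> \<noteq> exp_of lt (cls f) \<Longrightarrow> lt \<beta> (exp_of lt (cls f))"
proof -
  have "newton (std_repr (cls f)) \<noteq> {}"
    using assms by (simp add: newton_std_repr cls_eq_zero_iff)
  from lead_exp[OF mo this, folded exp_of_def]
  show "coord (exp_of lt (cls f)) f \<noteq> 0"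
    "coord \<beta> f \<noteq> 0 \<Longrightarrow> \<beta> \<noteq> exp_of lt (cls f) \<Longrightarrow> lt \<beta> (exp_of lt (cls f))"
    by (simp_all add: newton_std_repr)
qed

text \<open>
  An element of \<open>H\<close> with leading exponent \<open>\<alpha>\<close> differs from a multiple of an element of \<open>L\<close> by an element
  of \<open>H\<close> that is zero or has a smaller leading exponent. Scalar multiples suffice, because \<open>\<alpha>\<close> itself
  is a leading exponent of \<open>L\<close>.
\<close>
lemma left_ideal_subset_if_exponents_subset:
  assumes L: "left_ideal L (G_alg c d)" and H: "left_ideal H (G_alg c d)" and "L \<subseteq> H"
    and exps: "exponents lt (G_alg c d) H \<subseteq> exponents lt (G_alg c d) L"
  shows "H \<subseteq> L"
proof -
  have zero: "\<zero>\<^bsub>G_alg c d\<^esub> \<in> L"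
    using left_ideal_residue_class(2)[OF L] by (simp add: residue_class_hom)
  have wf: "wfp lt" using mo by (simp add: monomial_ordering_def)
  have "cls f \<in> H \<Longrightarrow> cls f \<noteq> \<zero>\<^bsub>G_alg c d\<^esub> \<Longrightarrow> exp_of lt (cls f) = \<alpha> \<Longrightarrow> cls f \<in> L" for f \<alpha>
  proof (induction \<alpha> arbitrary: f rule: wfp_induct_rule[OF wf])
    case (1 \<alpha>)
    then have "\<alpha> \<in> exponents lt (G_alg c d) H" unfolding exponents_def by blast
    then have "\<alpha> \<in> exponents lt (G_alg c d) L" using exps by blast
    then obtain g where g: "cls g \<in> L" "cls g \<noteq> \<zero>\<^bsub>G_alg c d\<^esub>" "exp_of lt (cls g) = \<alpha>"
      unfolding exponents_def using left_ideal_residue_class(1)[OF L] by fastforce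
    let ?q = "const (coord \<alpha> f / coord \<alpha> g)"
    let ?r = "f - ?q * g"
    have nz: "coord \<alpha> g \<noteq> 0" using exp_of_cls(1)[OF g(2)] g(3) by simp
    have r: "coord \<beta> ?r = coord \<beta> f - coord \<alpha> f / coord \<alpha> g * coord \<beta> g" for \<beta>
      by (simp add: lin_ext_diff lin_ext_const_mult)
    have "cls ?r \<in> L"
    proof (cases "cls ?r = \<zero>\<^bsub>G_alg c d\<^esub>")
      case False
      have "coord \<alpha> ?r = 0" using nz by (simp add: r)
      then have ne: "exp_of lt (cls ?r) \<noteq> \<alpha>" using exp_of_cls(1)[OF False] by auto
      have "coord (exp_of lt (cls ?r)) f \<noteq> 0 \<or> coord (exp_of lt (cls ?r)) g \<noteq> 0"
        using exp_of_cls(1)[OF False] by (auto simp: r)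
      then have "lt (exp_of lt (cls ?r)) \<alpha>"
        using exp_of_cls(2)[OF g(2)] exp_of_cls(2)[OF 1(3)] g(3) 1(4) ne by metis
      moreover have "cls ?r \<in> H"
        using left_ideal_residue_class_diff[OF H 1(2)] g(1) \<open>L \<subseteq> H\<close> by blast
      ultimately show ?thesis using 1(1) False by blast
    qed (simp add: zero)
    from left_ideal_residue_class_diff[OF L this g(1), of "- ?q"] show ?case by simp
  qed
  then have mem: "cls f \<in> L" if "cls f \<in> H" for f
    using zero that by (cases "cls f = \<zero>\<^bsub>G_alg c d\<^esub>") auto
  show ?thesis
  proof
    fix a assume "a \<in> H"
    moreover from this obtain f where "a = cls f"
      using left_ideal_residue_class(1)[OF H] by blast
    ultimately show "a \<in> L" using mem by simp
  qed
qed

end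

section \<open>Integral coordinates and their reduction\<close>

lemma red_coeff_of_int: "red_coeff (of_int m) = of_int m"
  by (simp add: red_coeff_def)

lemma red_coeff_0 [simp]: "red_coeff 0 = 0" and red_coeff_1 [simp]: "red_coeff 1 = 1"
  by (simp_all add: red_coeff_def)

lemma red_coeff_hom:
  assumes "x \<in> \<int>" "y \<in> \<int>"
  shows "red_coeff (x + y) = red_coeff x + red_coeff y"
    "red_coeff (x * y) = red_coeff x * red_coeff y"
  using assms unfolding Ints_def
  by (auto simp: red_coeff_of_int simp flip: of_int_add of_int_mult)

lemma red_coeff_sum:
  assumes "\<And>x. x \<in> S \<Longrightarrow> f x \<in> \<int>"
  shows "red_coeff (\<Sum>x\<in>S. f x) = (\<Sum>x\<in>S. red_coeff (f x))"
  using assms by (induction S rule: infinite_finite_induct) (auto simp: red_coeff_hom Ints_sum)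

lemma lookup_red_poly [simp]: "coeff_at (red_poly f) w = red_coeff (coeff_at f w)"
  by (simp add: red_poly_def Poly_Mapping.map.rep_eq when_def)

lemma keys_red_poly: "Poly_Mapping.keys (red_poly f) \<subseteq> Poly_Mapping.keys f"
  by (auto simp: in_keys_iff)

lemma lin_ext_in_Ints: "integral_poly f \<Longrightarrow> (\<And>w. \<phi> w \<in> \<int>) \<Longrightarrow> lin_ext \<phi> f \<in> \<int>"
  by (simp add: lin_ext_def integral_poly_def Ints_sum)

lemma lin_ext_red_poly:
  assumes "integral_poly f" "\<And>w. \<phi> w \<in> \<int>"
  shows "lin_ext (\<lambda>w. red_coeff (\<phi> w)) (red_poly f) = red_coeff (lin_ext \<phi> f)"
proof -
  have "lin_ext (\<lambda>w. red_coeff (\<phi> w)) (red_poly f)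
      = (\<Sum>w\<in>Poly_Mapping.keys f. red_coeff (coeff_at f w) * red_coeff (\<phi> w))"
    using lin_ext_superset[OF finite_keys keys_red_poly] by simp
  then show ?thesis
    using assms by (simp add: lin_ext_def red_coeff_sum red_coeff_hom integral_poly_def)
qed

lemma lin_ext_red_poly_mult:
  assumes "integral_poly f" "integral_poly g" "\<And>w. \<phi> w \<in> \<int>"
  shows "lin_ext (\<lambda>w. red_coeff (\<phi> w)) (red_poly f * red_poly g) = red_coeff (lin_ext \<phi> (f * g))"
  using assms by (simp add: lin_ext_mult lin_ext_red_poly lin_ext_in_Ints)

lemma integral_lift_exists:
  fixes h :: "('n, 'p::prime_card mod_ring) free_poly"
  shows "\<exists>h'. integral_poly h' \<and> red_poly h' = h"
proof -
  define h' :: "('n, rat) free_poly"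
    where "h' = Poly_Mapping.map (\<lambda>x. of_int (to_int_mod_ring x)) h"
  have h': "coeff_at h' w = of_int (to_int_mod_ring (coeff_at h w))" for w
    by (simp add: h'_def Poly_Mapping.map.rep_eq when_def)
  have "red_poly h' = h"
    by (rule poly_mapping_eqI) (simp add: h' red_coeff_of_int of_int_of_int_mod_ring)
  then show ?thesis
    by (intro exI[of _ h']) (auto simp: integral_poly_def h')
qed

definition restrict_keys :: "('w \<Rightarrow> bool) \<Rightarrow> ('w \<Rightarrow>\<^sub>0 'k::field) \<Rightarrow> ('w \<Rightarrow>\<^sub>0 'k)" where
  "restrict_keys P f = (\<Sum>w\<in>{w \<in> Poly_Mapping.keys f. P w}. Poly_Mapping.single w (coeff_at f w))"

lemma lookup_restrict_keys: "coeff_at (restrict_keys P f) w = (if P w then coeff_at f w else 0)"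
proof -
  have "coeff_at (restrict_keys P f) w = (\<Sum>v\<in>{v \<in> Poly_Mapping.keys f. P v}. if v = w then coeff_at f w else 0)"
    unfolding restrict_keys_def lookup_sum by (rule sum.cong) (auto simp: lookup_single when_def)
  then show ?thesis by (simp add: in_keys_iff)
qed

lemma lin_ext_restrict_keys: "lin_ext \<phi> (restrict_keys P f) = lin_ext (\<lambda>w. if P w then \<phi> w else 0) f"
proof -
  have "lin_ext \<phi> (restrict_keys P f) = (\<Sum>w\<in>Poly_Mapping.keys f. coeff_at (restrict_keys P f) w * \<phi> w)"
    by (rule lin_ext_superset) (auto simp: in_keys_iff lookup_restrict_keys split: if_splits)
  then show ?thesis
    by (auto simp: lin_ext_def lookup_restrict_keys intro!: sum.cong)
qed

lemma wdeg_add: "wdeg \<omega> (\<alpha> + \<beta>) = wdeg \<omega> \<alpha> + wdeg \<omega> \<beta>"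
  by (simp add: wdeg_def lookup_add distrib_left sum.distrib)

text \<open>
  This is where positivity of the weights enters: it makes degreewise counting conclusive.
\<close>
lemma finite_wdeg:
  fixes \<omega> :: "'n::finite \<Rightarrow> nat"
  assumes "\<And>i. \<omega> i \<ge> 1"
  shows "finite {\<alpha>. wdeg \<omega> \<alpha> = D}"
proof -
  have "coeff_at \<alpha> i \<le> wdeg \<omega> \<alpha>" for \<alpha> i
  proof -
    have "coeff_at \<alpha> i \<le> \<omega> i * coeff_at \<alpha> i" using assms[of i] by simp
    also have "\<dots> \<le> wdeg \<omega> \<alpha>" unfolding wdeg_def by (rule member_le_sum) auto
    finally show ?thesis .
  qed
  then have "coeff_at ` {\<alpha>. wdeg \<omega> \<alpha> = D} \<subseteq> {f. \<forall>i. (i \<in> UNIV \<longrightarrow> f i \<in> {..D}) \<and> (i \<notin> UNIV \<longrightarrow> f i = 0)}"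
    by auto
  moreover have "finite {f :: 'n \<Rightarrow> nat. \<forall>i. (i \<in> UNIV \<longrightarrow> f i \<in> {..D}) \<and> (i \<notin> UNIV \<longrightarrow> f i = 0)}"
    by (rule finite_set_of_finite_funs) auto
  ultimately have "finite (coeff_at ` {\<alpha>. wdeg \<omega> \<alpha> = D})"
    by (rule finite_subset)
  then show ?thesis
    by (rule finite_imageD) (auto simp: inj_on_def poly_mapping_eqI)
qed

text \<open>
  Fraction-free Gaussian elimination: more vectors than coordinates are linearly dependent, with
  coefficients in the domain itself.
\<close>
lemma idom_linear_dependence:
  fixes M :: "'s \<Rightarrow> 't \<Rightarrow> 'a::idom"
  assumes "finite T" "finite S" "card T < card S"
  shows "\<exists>b. (\<exists>s\<in>S. b s \<noteq> 0) \<and> (\<forall>t\<in>T. (\<Sum>s\<in>S. b s * M s t) = 0)"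
  using assms
proof (induction T arbitrary: S M rule: finite_induct)
  case empty
  then obtain s where "s \<in> S" by fastforce
  then show ?case by (intro exI[of _ "\<lambda>_. 1"]) auto
next
  case (insert t T)
  show ?case
  proof (cases "\<forall>s\<in>S. M s t = 0")
    case True
    then show ?thesis using insert.IH[of S M] insert.prems insert.hyps by auto
  next
    case False
    then obtain z where z: "z \<in> S" "M z t \<noteq> 0" by blast
    have "card T < card (S - {z})" using insert z by simp
    from insert.IH[OF _ this, of "\<lambda>s u. M z t * M s u - M s t * M z u"] insert.prems
    obtain b where b: "\<exists>s\<in>S - {z}. b s \<noteq> 0"
      "\<And>u. u \<in> T \<Longrightarrow> (\<Sum>s\<in>S - {z}. b s * (M z t * M s u - M s t * M z u)) = 0"
      by auto
    define e where "e s = (if s = z then - (\<Sum>s\<in>S - {z}. b s * M s t) else M z t * b s)" for s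
    have "(\<Sum>s\<in>S. e s * M s u) = (\<Sum>s\<in>S - {z}. b s * (M z t * M s u - M s t * M z u))" for u
    proof -
      have "(\<Sum>s\<in>S. e s * M s u) = e z * M z u + (\<Sum>s\<in>S - {z}. e s * M s u)"
        using z insert.prems by (simp add: sum.remove)
      also have "(\<Sum>s\<in>S - {z}. e s * M s u) = (\<Sum>s\<in>S - {z}. M z t * b s * M s u)"
        by (rule sum.cong) (auto simp: e_def)
      finally show ?thesis
        by (simp add: e_def algebra_simps sum_distrib_left sum_distrib_right sum_subtractf)
    qed
    moreover from this[of t] have "(\<Sum>s\<in>S. e s * M s t) = 0" by (simp add: mult.commute)
    moreover have "\<exists>s\<in>S. e s \<noteq> 0" using b(1) z by (auto simp: e_def)
    ultimately show ?thesis using b(2) by (intro exI[of _ e]) auto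
  qed
qed

text \<open>
  Dividing a dependence by the greatest common divisor of its coefficients makes it survive
  reduction modulo \<open>p\<close>.
\<close>
lemma primitive_linear_dependence:
  fixes M :: "'s \<Rightarrow> 't \<Rightarrow> int"
  assumes "finite T" "finite S" "card T < card S" and p: "\<not> p dvd 1"
  shows "\<exists>b. (\<exists>s\<in>S. \<not> p dvd b s) \<and> (\<forall>t\<in>T. (\<Sum>s\<in>S. b s * M s t) = 0)"
proof -
  obtain b where b: "\<exists>s\<in>S. b s \<noteq> 0" "\<And>t. t \<in> T \<Longrightarrow> (\<Sum>s\<in>S. b s * M s t) = 0"
    using idom_linear_dependence[OF assms(1-3), of M] by blast
  define g where "g = Gcd (b ` S)"
  have g0: "g \<noteq> 0" using b(1) by (auto simp: g_def)
  define e where "e s = b s div g" for s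
  have be: "b s = g * e s" if "s \<in> S" for s
    using that by (simp add: e_def g_def)
  have "\<exists>s\<in>S. \<not> p dvd e s"
  proof (rule ccontr)
    assume "\<not> ?thesis"
    then have "g * p dvd b s" if "s \<in> S" for s using be[OF that] that by simp
    then have "g * p dvd g" unfolding g_def by (intro Gcd_greatest) (auto simp: g_def)
    then show False using g0 p by simp
  qed
  moreover have "(\<Sum>s\<in>S. e s * M s t) = 0" if "t \<in> T" for t
  proof -
    have "g * (\<Sum>s\<in>S. e s * M s t) = (\<Sum>s\<in>S. b s * M s t)"
      by (simp add: sum_distrib_left be mult.assoc)
    then show ?thesis using b(2)[OF that] g0 by simp
  qed
  ultimately show ?thesis by blast
qed

text \<open>
  The rational side of the comparison: integral relations that are homogeneous for the weights \<open>\<omega>\<close>, in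
  the form in which rewriting uses this.
\<close>
locale integral_coordinates = coordinates lt c d N
  for lt :: "'n::{finite,linorder} expo \<Rightarrow> 'n expo \<Rightarrow> bool"
    and c :: "('n, rat) coeffs" and d :: "('n, rat) tails"
    and N :: "'n expo \<Rightarrow> 'n fword \<Rightarrow> rat" +
  fixes \<omega> :: "'n \<Rightarrow> nat"
  assumes integral_rel: "i < j \<Longrightarrow> c i j \<in> \<int>" "i < j \<Longrightarrow> integral_poly (d i j)"
    and homogeneous_tails:
      "i < j \<Longrightarrow> w \<in> Poly_Mapping.keys (d i j) \<Longrightarrow> wdeg \<omega> (expo_of w) = wdeg \<omega> (unit_expo i + unit_expo j)"
begin

lemma N_in_Ints: "N \<beta> w \<in> \<int>"
proof (induction w rule: word_reduction_induct[OF mo tails, case_names sorted descent])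
  case (sorted w)
  then show ?case using sorted_word_eq[OF sorted] N_std_word by (metis Ints_0 Ints_1)
next
  case (descent u i j v)
  have "N \<beta> (u + Word [j, i] + v) = reduct c d (N \<beta>) u i j v"
    using compat[of \<beta>] descent(1) by (simp add: compatible_def)
  then show ?case
    using descent integral_rel
    by (auto simp: reduct_def lin_ext_def integral_poly_def intro!: Ints_add Ints_mult Ints_sum)
qed

lemma N_degree: "N \<beta> w \<noteq> 0 \<Longrightarrow> wdeg \<omega> \<beta> = wdeg \<omega> (expo_of w)"
proof (induction w rule: word_reduction_induct[OF mo tails, case_names sorted descent])
  case (sorted w)
  then show ?case using sorted_word_eq[OF sorted(1)] N_std_word by metis
next
  case (descent u i j v)
  have "N \<beta> (u + Word [j, i] + v) = reduct c d (N \<beta>) u i j v"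
    using compat[of \<beta>] descent(1) by (simp add: compatible_def)
  with descent(4) consider "N \<beta> (u + Word [i, j] + v) \<noteq> 0"
    | s where "s \<in> Poly_Mapping.keys (d i j)" "N \<beta> (u + s + v) \<noteq> 0"
    by (fastforce simp: reduct_def lin_ext_def intro: sum.neutral)
  then show ?case
  proof cases
    case 1
    with descent(2) show ?thesis by (simp add: expo_of_Word wdeg_add)
  next
    case 2
    with descent(3)[OF 2] homogeneous_tails[OF descent(1) 2(1)] show ?thesis
      by (simp add: expo_of_Word wdeg_add)
  qed
qed

text \<open>
  The values of \<open>N \<beta>\<close> on words satisfy the relations as an identity between integers, which
  therefore also holds modulo \<open>p\<close>.
\<close>
lemma coordinates_mod:
  "coordinates lt (red_coeffs c) (red_tails d) (\<lambda>\<beta> w. red_coeff (N \<beta> w) :: 'p::prime_card mod_ring)"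
proof
  show "monomial_ordering lt" by (rule mo)
  show "small_tails lt (red_tails d :: ('n, 'p mod_ring) tails)"
    using tails keys_red_poly unfolding small_tails_def red_tails_def by blast
  show "compatible (red_coeffs c) (red_tails d) (\<lambda>w. red_coeff (N \<beta> w) :: 'p mod_ring)" for \<beta>
    unfolding compatible_def
  proof (intro allI impI)
    fix u i j v assume ij: "(i::'n) < j"
    have "N \<beta> (u + Word [j, i] + v) = reduct c d (N \<beta>) u i j v"
      using compat[of \<beta>] ij by (simp add: compatible_def)
    then show "(red_coeff (N \<beta> (u + Word [j, i] + v)) :: 'p mod_ring)
        = reduct (red_coeffs c) (red_tails d) (\<lambda>w. red_coeff (N \<beta> w)) u i j v"
      using integral_rel[OF ij]
      by (simp add: reduct_def red_coeff_hom N_in_Ints lin_ext_in_Ints red_coeffs_def red_tails_def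
          lin_ext_red_poly[where \<phi> = "\<lambda>w. N \<beta> (u + w + v)"])
  qed
  show "(red_coeff (N \<beta> (std_word \<gamma>)) :: 'p mod_ring) = (if \<gamma> = \<beta> then 1 else 0)" for \<beta> \<gamma>
    by (simp add: N_std_word)
qed

text \<open>
  The degree-\<open>D\<close> component of an element of the ideal modulo \<open>p\<close> lifts to the rational ideal with
  integral coordinates. Write the element as \<open>\<Sum> h\<^sub>f f\<^sub>p\<close>, lift the coefficients of each \<open>h\<^sub>f\<close> to
  integers, and keep only those words \<open>w\<close> of \<open>h\<^sub>f\<close> for which \<open>w f\<close> has degree \<open>D\<close>. Since coordinates preserve degree, the
  discarded words contribute only to other degrees.
\<close>
lemma homogeneous_lift_exists:
  fixes fs :: "('n, rat) free_poly set list" and a :: "('n, 'p::prime_card mod_ring) free_poly set"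
  assumes fs: "set fs \<subseteq> carrier (G_alg c d)"
    and hom: "\<And>f. f \<in> set fs \<Longrightarrow> homogeneous \<omega> (std_repr f)"
    and int: "\<And>f. f \<in> set fs \<Longrightarrow> integral_poly (std_repr f)"
    and a: "a \<in> left_ideal_gen (G_alg_mod c d) (red_elem c d ` set fs)"
  shows "\<exists>g. cls g \<in> left_ideal_gen (G_alg c d) (set fs) \<and>
    (\<forall>\<beta>. coord \<beta> g \<in> \<int>) \<and> (\<forall>\<beta>. wdeg \<omega> \<beta> \<noteq> D \<longrightarrow> coord \<beta> g = 0) \<and>
    (\<forall>\<beta>. wdeg \<omega> \<beta> = D \<longrightarrow> red_coeff (coord \<beta> g) = coeff_at (std_repr a) (std_word \<beta>))"
proof -
  interpret p: coordinates lt "red_coeffs c" "red_tails d"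
      "\<lambda>\<beta> w. red_coeff (N \<beta> w) :: 'p mod_ring"
    by (rule coordinates_mod)
  have cls_repr: "cls (std_repr f) = f" "standard (std_repr f)" if "f \<in> set fs" for f
    using that fs std_repr_cls(1,2) by (auto simp: carrier_G_alg)
  obtain e where e: "\<And>f \<alpha>. f \<in> set fs \<Longrightarrow> \<alpha> \<in> newton (std_repr f) \<Longrightarrow> wdeg \<omega> \<alpha> = e f"
    using hom unfolding homogeneous_def by metis
  have "a \<in> left_ideal_gen (G_alg (red_coeffs c) (red_tails d))
      ((\<lambda>f. p.cls (red_poly (std_repr f))) ` set fs)"
    using a by (simp add: G_alg_mod_def red_elem_def[abs_def])
  from left_ideal_gen_combination[OF finite_set this]
  obtain h where h: "a = p.cls (\<Sum>f\<in>set fs. h f * red_poly (std_repr f))"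
    by (rule exE)
  have "\<forall>f. \<exists>h'. integral_poly h' \<and> red_poly h' = h f"
    by (intro allI integral_lift_exists)
  from choice[OF this] obtain h'
    where h': "\<And>f. integral_poly (h' f)" "\<And>f. red_poly (h' f) = h f"
    by auto
  define P where "P f w \<longleftrightarrow> wdeg \<omega> (expo_of w) + e f = D" for f w
  define g where "g = (\<Sum>f\<in>set fs. restrict_keys (P f) (h' f) * std_repr f)"
  have deg: "N \<beta> (w + v) \<noteq> 0 \<Longrightarrow> wdeg \<omega> \<beta> = wdeg \<omega> (expo_of w) + e f"
    if f: "f \<in> set fs" and v: "v \<in> Poly_Mapping.keys (std_repr f)" for f v w \<beta>
  proof -
    obtain \<alpha> where \<alpha>: "v = std_word \<alpha>"
      using v cls_repr(2)[OF f] by (auto simp: standard_def)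
    with v have "\<alpha> \<in> newton (std_repr f)" by (simp add: newton_def in_keys_iff)
    then have "wdeg \<omega> (expo_of v) = e f" using e[OF f] by (simp add: \<alpha>)
    then show "N \<beta> (w + v) \<noteq> 0 \<Longrightarrow> wdeg \<omega> \<beta> = wdeg \<omega> (expo_of w) + e f"
      using N_degree[of \<beta> "w + v"] by (simp add: wdeg_add)
  qed
  have off: "lin_ext (\<lambda>v. N \<beta> (w + v)) (std_repr f) = 0"
    if "f \<in> set fs" "wdeg \<omega> \<beta> \<noteq> wdeg \<omega> (expo_of w) + e f" for f \<beta> w
    unfolding lin_ext_def using deg[OF that(1)] that(2) by (intro sum.neutral) fastforce
  have restrict: "coord \<beta> (restrict_keys (P f) (h' f) * std_repr f)
      = (if wdeg \<omega> \<beta> = D then coord \<beta> (h' f * std_repr f) else 0)" if f: "f \<in> set fs" for f \<beta>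
  proof -
    have "(\<lambda>w. if P f w then lin_ext (\<lambda>v. N \<beta> (w + v)) (std_repr f) else 0)
        = (\<lambda>w. if wdeg \<omega> \<beta> = D then lin_ext (\<lambda>v. N \<beta> (w + v)) (std_repr f) else 0)"
      using off[OF f, of \<beta>] by (auto simp: P_def fun_eq_iff)
    then show ?thesis
      by (simp add: lin_ext_mult lin_ext_restrict_keys) (simp add: lin_ext_def)
  qed
  have int_h': "coord \<beta> (h' f * std_repr f) \<in> \<int>" if "f \<in> set fs" for f \<beta>
    using h'(1) int[OF that] by (simp add: lin_ext_mult lin_ext_in_Ints N_in_Ints)
  have coord_g: "coord \<beta> g = (if wdeg \<omega> \<beta> = D then \<Sum>f\<in>set fs. coord \<beta> (h' f * std_repr f) else 0)" for \<beta>
    by (simp add: g_def lin_ext_sum restrict)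
  have "cls g \<in> left_ideal_gen (G_alg c d) (set fs)"
    unfolding g_def
    using left_ideal_gen_superset[of "set fs" "G_alg c d"]
    by (intro left_ideal_residue_class_sum left_ideal_left_ideal_gen fs) (auto simp: cls_repr)
  moreover have "coord \<beta> g \<in> \<int>" for \<beta>
    by (auto simp: coord_g int_h' intro!: Ints_sum)
  moreover have "red_coeff (coord \<beta> g) = coeff_at (std_repr a) (std_word \<beta>)" if "wdeg \<omega> \<beta> = D" for \<beta>
  proof -
    have "red_coeff (coord \<beta> g) = (\<Sum>f\<in>set fs. red_coeff (coord \<beta> (h' f * std_repr f)))"
      by (simp add: coord_g that red_coeff_sum int_h')
    also have "\<dots> = (\<Sum>f\<in>set fs. p.coord \<beta> (h f * red_poly (std_repr f)))"
      unfolding h'(2)[symmetric]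
      by (intro sum.cong refl lin_ext_red_poly_mult[symmetric] h'(1) int N_in_Ints)
    also have "\<dots> = coeff_at (std_repr a) (std_word \<beta>)"
      by (simp add: h p.std_repr_cls(3) lin_ext_sum)
    finally show ?thesis .
  qed
  ultimately show ?thesis
    using coord_g by (intro exI[of _ g]) auto
qed

end

section \<open>Comparing leading exponents modulo a prime\<close>
context integral_coordinates
begin

text \<open>
  Semicontinuity of the Hilbert function under reduction. For each of the exponents \<open>\<alpha> \<in> S\<close> of the
  ideal modulo \<open>p\<close> choose a lift \<open>g \<alpha>\<close> in \<open>L\<close>. If \<open>L\<close> had fewer exponents, forming the set \<open>T\<close>, there would be an
  integral combination \<open>f\<close> of the lifts, with coefficients not all divisible by \<open>p\<close>, whose
  coordinates at \<open>T\<close> vanish. As the leading exponent of a nonzero element of \<open>L\<close> of degree \<open>D\<close> lies in \<open>T\<close>,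
  the combination is zero in \<open>A\<close>. But then the reduced elements, whose leading exponents are distinct,
  would be linearly dependent.
\<close>
lemma card_exponents_mod_le:
  fixes fs :: "('n, rat) free_poly set list" and Lp :: "('n, 'p::prime_card mod_ring) free_poly set set"
  assumes fs: "set fs \<subseteq> carrier (G_alg c d)"
    and hom: "\<And>f. f \<in> set fs \<Longrightarrow> homogeneous \<omega> (std_repr f)"
    and int: "\<And>f. f \<in> set fs \<Longrightarrow> integral_poly (std_repr f)"
    and \<omega>: "\<And>i. \<omega> i \<ge> 1"
    and L: "L = left_ideal_gen (G_alg c d) (set fs)"
    and Lp: "Lp = left_ideal_gen (G_alg_mod c d) (red_elem c d ` set fs)"
  shows "card {\<alpha> \<in> exponents lt (G_alg_mod c d) Lp. wdeg \<omega> \<alpha> = D}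
    \<le> card {\<alpha> \<in> exponents lt (G_alg c d) L. wdeg \<omega> \<alpha> = D}"
proof (rule ccontr)
  interpret p: coordinates lt "red_coeffs c" "red_tails d"
      "\<lambda>\<beta> w. red_coeff (N \<beta> w) :: 'p mod_ring"
    by (rule coordinates_mod)
  define S where "S = {\<alpha> \<in> exponents lt (G_alg_mod c d) Lp. wdeg \<omega> \<alpha> = D}"
  define T where "T = {\<alpha> \<in> exponents lt (G_alg c d) L. wdeg \<omega> \<alpha> = D}"
  assume "\<not> ?thesis"
  then have card: "card T < card S" by (simp add: S_def T_def)
  have fin: "finite S" "finite T"
    using finite_wdeg[where \<omega> = \<omega> and D = D, OF \<omega>] by (auto simp: S_def T_def elim: rev_finite_subset)
  have lideal: "left_ideal L (G_alg c d)"
    unfolding L by (rule left_ideal_left_ideal_gen[OF fs])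
  have lideal_p: "Lp \<subseteq> range p.cls"
    unfolding Lp G_alg_mod_def
    by (intro left_ideal_residue_class(1) left_ideal_left_ideal_gen)
      (auto simp: red_elem_def carrier_G_alg)
  have "\<forall>\<alpha>\<in>S. \<exists>g. cls g \<in> L \<and> (\<forall>\<beta>. coord \<beta> g \<in> \<int>) \<and> (\<forall>\<beta>. wdeg \<omega> \<beta> \<noteq> D \<longrightarrow> coord \<beta> g = 0)
      \<and> (red_coeff (coord \<alpha> g) :: 'p mod_ring) \<noteq> 0
      \<and> (\<forall>\<beta>. (red_coeff (coord \<beta> g) :: 'p mod_ring) \<noteq> 0 \<longrightarrow> \<beta> \<noteq> \<alpha> \<longrightarrow> lt \<beta> \<alpha>)"
  proof
    fix \<alpha> assume "\<alpha> \<in> S"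
    then obtain a where a: "a \<in> Lp" "a \<noteq> \<zero>\<^bsub>G_alg_mod c d\<^esub>" "\<alpha> = exp_of lt a" and D: "wdeg \<omega> \<alpha> = D"
      by (auto simp: S_def exponents_def)
    obtain f where f: "a = p.cls f" using a(1) lideal_p by blast
    have nz: "p.cls f \<noteq> \<zero>\<^bsub>G_alg (red_coeffs c) (red_tails d)\<^esub>" using a(2) f by (simp add: G_alg_mod_def)
    obtain g where g: "cls g \<in> L" "\<And>\<beta>. coord \<beta> g \<in> \<int>" "\<And>\<beta>. wdeg \<omega> \<beta> \<noteq> D \<Longrightarrow> coord \<beta> g = 0"
      "\<And>\<beta>. wdeg \<omega> \<beta> = D \<Longrightarrow> red_coeff (coord \<beta> g) = coeff_at (std_repr a) (std_word \<beta>)"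
      using homogeneous_lift_exists[OF fs hom int a(1)[unfolded Lp], of D] unfolding L by blast
    have red: "red_coeff (coord \<beta> g) = (if wdeg \<omega> \<beta> = D then p.coord \<beta> f else 0)" for \<beta>
      using g(3,4) by (simp add: f p.std_repr_cls(3))
    show "\<exists>g. cls g \<in> L \<and> (\<forall>\<beta>. coord \<beta> g \<in> \<int>) \<and> (\<forall>\<beta>. wdeg \<omega> \<beta> \<noteq> D \<longrightarrow> coord \<beta> g = 0)
      \<and> (red_coeff (coord \<alpha> g) :: 'p mod_ring) \<noteq> 0
      \<and> (\<forall>\<beta>. (red_coeff (coord \<beta> g) :: 'p mod_ring) \<noteq> 0 \<longrightarrow> \<beta> \<noteq> \<alpha> \<longrightarrow> lt \<beta> \<alpha>)"
      using g(1-3) red D p.exp_of_cls[OF nz] a(3) f by (intro exI[of _ g]) (auto split: if_splits)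
  qed
  then obtain g where g: "\<And>\<alpha>. \<alpha> \<in> S \<Longrightarrow> cls (g \<alpha>) \<in> L" "\<And>\<alpha> \<beta>. \<alpha> \<in> S \<Longrightarrow> coord \<beta> (g \<alpha>) \<in> \<int>"
    "\<And>\<alpha> \<beta>. \<alpha> \<in> S \<Longrightarrow> wdeg \<omega> \<beta> \<noteq> D \<Longrightarrow> coord \<beta> (g \<alpha>) = 0"
    "\<And>\<alpha>. \<alpha> \<in> S \<Longrightarrow> (red_coeff (coord \<alpha> (g \<alpha>)) :: 'p mod_ring) \<noteq> 0"
    "\<And>\<alpha> \<beta>. \<alpha> \<in> S \<Longrightarrow> (red_coeff (coord \<beta> (g \<alpha>)) :: 'p mod_ring) \<noteq> 0 \<Longrightarrow> \<beta> \<noteq> \<alpha> \<Longrightarrow> lt \<beta> \<alpha>"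
    unfolding bchoice_iff by blast
  have "prime CARD('p)" by (rule prime_card)
  then have p1: "\<not> int CARD('p) dvd 1" by (auto simp: prime_nat_iff)
  obtain b where b: "\<exists>\<alpha>\<in>S. \<not> int CARD('p) dvd b \<alpha>"
    "\<And>\<tau>. \<tau> \<in> T \<Longrightarrow> (\<Sum>\<alpha>\<in>S. b \<alpha> * \<lfloor>coord \<tau> (g \<alpha>)\<rfloor>) = 0"
    using primitive_linear_dependence[OF fin(2,1) card p1, of "\<lambda>\<alpha> \<tau>. \<lfloor>coord \<tau> (g \<alpha>)\<rfloor>"] by blast
  define f where "f = (\<Sum>\<alpha>\<in>S. const (of_int (b \<alpha>)) * g \<alpha>)"
  have coord_f: "coord \<beta> f = (\<Sum>\<alpha>\<in>S. of_int (b \<alpha>) * coord \<beta> (g \<alpha>))" for \<beta>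
    by (simp add: f_def lin_ext_sum lin_ext_const_mult)
  have f_L: "cls f \<in> L"
    unfolding f_def using g(1) by (rule left_ideal_residue_class_sum[OF lideal])
  have "cls f = \<zero>\<^bsub>G_alg c d\<^esub>"
  proof (rule ccontr)
    assume nz: "cls f \<noteq> \<zero>\<^bsub>G_alg c d\<^esub>"
    let ?\<tau> = "exp_of lt (cls f)"
    have "coord ?\<tau> f \<noteq> 0" by (rule exp_of_cls(1)[OF nz])
    moreover have "wdeg \<omega> ?\<tau> = D"
      using calculation g(3) by (auto simp: coord_f intro: ccontr)
    then have "?\<tau> \<in> T" using f_L nz by (auto simp: T_def exponents_def)
    then have "of_int (\<Sum>\<alpha>\<in>S. b \<alpha> * \<lfloor>coord ?\<tau> (g \<alpha>)\<rfloor>) = (0 :: rat)" using b(2) by simp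
    then have "coord ?\<tau> f = 0" using g(2) by (simp add: coord_f)
    ultimately show False by blast
  qed
  then have zero: "(\<Sum>\<alpha>\<in>S. of_int (b \<alpha>) * red_coeff (coord \<beta> (g \<alpha>))) = (0 :: 'p mod_ring)" for \<beta>
  proof -
    assume "cls f = \<zero>\<^bsub>G_alg c d\<^esub>"
    then have "red_coeff (coord \<beta> f) = (0 :: 'p mod_ring)" by (simp add: cls_eq_zero_iff)
    then show ?thesis
      using g(2) by (simp add: coord_f red_coeff_sum red_coeff_hom red_coeff_of_int)
  qed
  (* mu is the largest exponent whose coefficient survives modulo p; no other surviving
     lift has a coordinate there *)
  define U where "U = {\<alpha> \<in> S. (of_int (b \<alpha>) :: 'p mod_ring) \<noteq> 0}"
  have "U \<noteq> {}" using b(1) by (auto simp: U_def of_int_eq_0_iff_char_dvd)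
  then obtain \<mu> where \<mu>: "\<mu> \<in> U" "\<forall>\<alpha>\<in>U. \<alpha> \<noteq> \<mu> \<longrightarrow> lt \<alpha> \<mu>"
    using monomial_ordering_max[OF mo, of U] fin by (auto simp: U_def)
  have others: "(of_int (b \<alpha>) * red_coeff (coord \<mu> (g \<alpha>)) :: 'p mod_ring) = 0" if "\<alpha> \<in> S - {\<mu>}" for \<alpha>
  proof (rule ccontr)
    assume nz: "\<not> ?thesis"
    then have "lt \<mu> \<alpha>" using g(5)[of \<alpha> \<mu>] that by auto
    moreover have "lt \<alpha> \<mu>" using \<mu>(2) nz that by (auto simp: U_def)
    ultimately show False using monomial_orderingD[OF mo] by blast
  qed
  have rest: "(\<Sum>\<alpha>\<in>S - {\<mu>}. of_int (b \<alpha>) * red_coeff (coord \<mu> (g \<alpha>))) = (0 :: 'p mod_ring)"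
    by (intro sum.neutral ballI others)
  have "(of_int (b \<mu>) * red_coeff (coord \<mu> (g \<mu>)) :: 'p mod_ring)
      = (\<Sum>\<alpha>\<in>S. of_int (b \<alpha>) * red_coeff (coord \<mu> (g \<alpha>)))"
    using \<mu>(1) fin(1) by (simp add: sum.remove[of S \<mu>] U_def rest)
  also have "\<dots> = 0" by (rule zero)
  finally have "(of_int (b \<mu>) * red_coeff (coord \<mu> (g \<mu>)) :: 'p mod_ring) = 0" .
  then show False using g(4) \<mu>(1) by (auto simp: U_def)
qed

end

text \<open>
  The word \<open>x\<^sub>i x\<^sub>j\<close> cannot cancel in \<open>c\<^sub>i\<^sub>j x\<^sub>i x\<^sub>j + d\<^sub>i\<^sub>j\<close>, since \<open>c\<^sub>i\<^sub>j\<close> is nonzero and \<open>d\<^sub>i\<^sub>j\<close> has smaller exponents; hence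
  homogeneity of the sum forces the degree of \<open>d\<^sub>i\<^sub>j\<close> to be that of \<open>x\<^sub>i x\<^sub>j\<close>.
\<close>
theorem integral_coordinates_exist:
  fixes c :: "('n::{finite,linorder}, rat) coeffs"
  assumes G: "G_algebra c d" and adm: "admissible lt d"
    and int: "\<And>i j. i < j \<Longrightarrow> c i j \<in> \<int> \<and> integral_poly (d i j)"
    and hom: "\<And>i j. i < j \<Longrightarrow> homogeneous \<omega> (rel_rhs c d i j)"
  shows "\<exists>N. integral_coordinates lt c d N \<omega>"
proof -
  have mo: "monomial_ordering lt" using adm by (simp add: admissible_def)
  have std: "standard (d i j)" and c: "c i j \<noteq> 0" if "i < j" for i j
    using G that by (auto simp: G_algebra_def)
  have tails: "small_tails lt d" by (rule small_tails_of_admissible[OF adm std])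
  have nd: "\<And>i j k. i < j \<Longrightarrow> j < k \<Longrightarrow> reduces_to_zero c d (nondeg c d i j k)"
    using G by (auto simp: G_algebra_def)
  have "\<forall>\<beta>. \<exists>\<phi>. compatible c d \<phi> \<and> (\<forall>\<alpha>. \<phi> (std_word \<alpha>) = (if \<alpha> = \<beta> then 1 else 0))"
    by (intro allI compatible_functional_exists[OF mo tails nd])
  then obtain N where N: "\<And>\<beta>. compatible c d (N \<beta>)"
    "\<And>\<beta> \<alpha>. N \<beta> (std_word \<alpha>) = (if \<alpha> = \<beta> then 1 else 0)"
    by metis
  have "wdeg \<omega> (expo_of w) = wdeg \<omega> (unit_expo i + unit_expo j)"
    if ij: "i < j" and w: "w \<in> Poly_Mapping.keys (d i j)" for i j w
  proof -
    have top: "std_word (unit_expo i + unit_expo j) = Word [i, j]"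
      using sorted_word_eq[of "Word [i, j]"] ij by (simp add: expo_of_Word)
    have coeff: "coeff_at (rel_rhs c d i j) v = (if v = Word [i, j] then c i j else 0) + coeff_at (d i j) v" for v
      by (simp add: rel_rhs_def const_mult_X_mult_X lookup_add lookup_single when_def)
    have less: "lt (expo_of v) (unit_expo i + unit_expo j)" if "v \<in> Poly_Mapping.keys (d i j)" for v
      using tails ij that by (simp add: small_tails_def)
    have top_notin: "Word [i, j] \<notin> Poly_Mapping.keys (d i j)"
      using less[of "Word [i, j]"] monomial_orderingD(1)[OF mo] by (auto simp: expo_of_Word)
    obtain \<alpha> where \<alpha>: "w = std_word \<alpha>" using std[OF ij] w by (auto simp: standard_def)
    have "unit_expo i + unit_expo j \<in> newton (rel_rhs c d i j)"
      using top_notin c[OF ij] by (simp add: newton_def top coeff in_keys_iff)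
    moreover have "\<alpha> \<in> newton (rel_rhs c d i j)"
      using w top_notin by (auto simp: newton_def coeff in_keys_iff \<alpha>)
    ultimately show ?thesis
      using hom[OF ij] by (auto simp: homogeneous_def \<alpha>)
  qed
  then have "integral_coordinates lt c d N \<omega>"
    using mo tails N int by unfold_locales auto
  then show ?thesis by blast
qed

section \<open>The modular Groebner basis criterion\<close>
theorem theorem27:
  fixes c :: "('n::{finite,linorder}, rat) coeffs"
    and d :: "('n, rat) tails"
    and lt :: "'n expo \<Rightarrow> 'n expo \<Rightarrow> bool"
    and \<omega> :: "'n \<Rightarrow> nat"
    and fs :: "('n, rat) free_poly set list"
    and I G :: "('n, rat) free_poly set set"
    and p :: nat
    and Gp :: "('n, 'p::prime_card mod_ring) free_poly set set"
  assumes "G_algebra c d"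
    and "\<And>i j. i < j \<Longrightarrow> c i j \<in> \<int> \<and> integral_poly (d i j)"
    and "admissible lt d"
    and "\<And>i. \<omega> i \<ge> 1"
    and "\<And>i j. i < j \<Longrightarrow> homogeneous \<omega> (rel_rhs c d i j)"
    and "set fs \<subseteq> carrier (G_alg c d)"
    and "\<And>f. f \<in> set fs \<Longrightarrow> homogeneous \<omega> (std_repr f) \<and> integral_poly (std_repr f)"
    and "I = left_ideal_gen (G_alg c d) (set fs)"
    and "I \<noteq> {\<zero>\<^bsub>G_alg c d\<^esub>}"
    and "finite G" and "G \<subseteq> carrier (G_alg c d) - {\<zero>\<^bsub>G_alg c d\<^esub>}"
    and "good_prime p c d" and "p = CARD('p)"
    and "reduced_groebner_basis lt (G_alg_mod c d) Gp
           (left_ideal_gen (G_alg_mod c d) (red_elem c d ` set fs))"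
    and "exp_of lt ` G = exp_of lt ` Gp"
    and "groebner_basis lt (G_alg c d) G (left_ideal_gen (G_alg c d) G)"
    and "I \<subseteq> left_ideal_gen (G_alg c d) G"
  shows "groebner_basis lt (G_alg c d) G I"
proof -
  define H where "H = left_ideal_gen (G_alg c d) G"
  define Ip where "Ip = left_ideal_gen (G_alg_mod c d :: ('n, 'p mod_ring) free_poly set ring) (red_elem c d ` set fs)"
  from integral_coordinates_exist[OF assms(1,3,2,5)]
  obtain N where "integral_coordinates lt c d N \<omega>" by (rule exE)
  then interpret integral_coordinates lt c d N \<omega> .
  have "exponents lt (G_alg c d) H = (\<Union>\<epsilon>\<in>exp_of lt ` G. range (\<lambda>\<gamma>. \<epsilon> + \<gamma>))"
    using assms(16) by (simp add: groebner_basis_def exponents_def H_def)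
  moreover have "exponents lt (G_alg_mod c d) Ip = (\<Union>\<epsilon>\<in>exp_of lt ` Gp. range (\<lambda>\<gamma>. \<epsilon> + \<gamma>))"
    using assms(14) by (simp add: reduced_groebner_basis_def groebner_basis_def exponents_def Ip_def)
  ultimately have H_Ip: "exponents lt (G_alg c d) H = exponents lt (G_alg_mod c d) Ip"
    using assms(15) by simp
  have I_H: "exponents lt (G_alg c d) I \<subseteq> exponents lt (G_alg c d) H"
    using assms(17) by (auto simp: exponents_def H_def)
  have "exponents lt (G_alg c d) H \<subseteq> exponents lt (G_alg c d) I"
  proof
    fix \<alpha> assume \<alpha>: "\<alpha> \<in> exponents lt (G_alg c d) H"
    let ?D = "wdeg \<omega> \<alpha>"
    let ?T = "{\<beta> \<in> exponents lt (G_alg c d) I. wdeg \<omega> \<beta> = ?D}"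
    let ?S = "{\<beta> \<in> exponents lt (G_alg c d) H. wdeg \<omega> \<beta> = ?D}"
    have "card ?S \<le> card ?T"
      unfolding H_Ip using assms(7)
      by (intro card_exponents_mod_le[OF assms(6) _ _ assms(4) assms(8) Ip_def]) auto
    moreover have "finite ?S"
      using finite_wdeg[where \<omega> = \<omega> and D = ?D, OF assms(4)] by (auto elim: rev_finite_subset)
    moreover have "?T \<subseteq> ?S" using I_H by auto
    ultimately have "?T = ?S" by (meson card_seteq)
    then show "\<alpha> \<in> exponents lt (G_alg c d) I" using \<alpha> by blast
  qed
  moreover have "left_ideal I (G_alg c d)"
    unfolding assms(8) by (rule left_ideal_left_ideal_gen[OF assms(6)])
  moreover have "left_ideal H (G_alg c d)"
    unfolding H_def using assms(11) by (intro left_ideal_left_ideal_gen) blast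
  ultimately have "H \<subseteq> I"
    using left_ideal_subset_if_exponents_subset assms(17) unfolding H_def by blast
  then have "I = left_ideal_gen (G_alg c d) G"
    using assms(17) by (simp add: H_def)
  then show ?thesis using assms(16) by simp
qed

end
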